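(* Let $\Omega_j$, $j=1,2,\dots,n$, be smooth finite-area domains in the plane $\mathbb{C}$ whose Cartesian product $\Omega=\prod_{j=1}^{n}\Omega_j\subset\mathbb{C}^n$ is of finite volume. Then $\Omega$ is a QDP if and only if each $\Omega_j$ is a QDP.
   Context: A domain is a nonempty connected open set; smooth means having $\mathcal{C}^\infty$ smooth boundary. For a domain $\Omega\subset\mathbb{C}^n$ ($n\ge1$), $H^2(\Omega)$ is the Bergman space of holomorphic functions on $\Omega$ square-integrable with respect to Lebesgue measure, and $K(z,w)$ is its Bergman kernel: holomorphic in $z$, antiholomorphic in $w$, with $\int_\Omega f(w)K(z,w)\,dV(w)=f(z)$ for all $f\in H^2(\Omega)$. The Bergman span of $\Omega$ is the complex linear span of the functions $z\mapsto\frac{\partial^\alpha}{\partial\bar w^\alpha}K(z,w)|_{w=w_0}$, where $\alpha$ ranges over multi-indices and $w_0$ ranges over $\Omega$. A domain of finite volume is a quadrature domain (for $H^2$ functions) if the constant function $1$ is in its Bergman span; equivalently, integration over $\Omega$ of functions in $H^2(\Omega)$ is given by a fixed finite linear combination of point evaluations of the functions and their derivatives. A QDP is a quadrature domain such that every holomorphic polynomial (restricted to the domain) is in its Bergman span. *)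

theory Defs
  imports "HOL-Analysis.Analysis"
begin

section \<open>Domains\<close>

definition is_domain :: "'a::topological_space set \<Rightarrow> bool" where
  "is_domain \<Omega> \<longleftrightarrow> \<Omega> \<noteq> {} \<and> open \<Omega> \<and> connected \<Omega>"

definition finite_volume :: "'a::euclidean_space set \<Rightarrow> bool" where
  "finite_volume \<Omega> \<longleftrightarrow> emeasure lborel \<Omega> < \<infinity>"

text \<open>\<open>C_k_on k f U\<close>: on the open set \<open>U\<close>, all iterated directional derivatives of \<open>f\<close> of
  order at most \<open>k\<close> exist and are continuous.\<close>

fun C_k_on :: "nat \<Rightarrow> ('a::real_normed_vector \<Rightarrow> real) \<Rightarrow> 'a set \<Rightarrow> bool" where
  "C_k_on 0 f U \<longleftrightarrow> continuous_on U f"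
| "C_k_on (Suc k) f U \<longleftrightarrow>
     (\<forall>x\<in>U. f differentiable (at x)) \<and>
     (\<forall>v. C_k_on k (\<lambda>x. frechet_derivative f (at x) v) U)"

definition C_infinity_on :: "('a::real_normed_vector \<Rightarrow> real) \<Rightarrow> 'a set \<Rightarrow> bool" where
  "C_infinity_on f U \<longleftrightarrow> (\<forall>k. C_k_on k f U)"

text \<open>Smooth boundary: near each boundary point there is a smooth local defining function with
  nonvanishing differential on its zero set (which then coincides locally with the boundary).
  Boundedness is not required.\<close>

definition smooth_boundary :: "'a::real_normed_vector set \<Rightarrow> bool" where
  "smooth_boundary \<Omega> \<longleftrightarrow>
     (\<forall>p\<in>frontier \<Omega>. \<exists>U (\<rho>::'a \<Rightarrow> real). open U \<and> p \<in> U \<and> C_infinity_on \<rho> U \<and>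
        \<Omega> \<inter> U = {x\<in>U. \<rho> x < 0} \<and>
        (\<forall>x\<in>U. \<rho> x = 0 \<longrightarrow> (\<exists>v. frechet_derivative \<rho> (at x) v \<noteq> 0)))"

section \<open>Bergman space and Bergman kernel\<close>

text \<open>A function on \<open>\<Omega>\<close> is represented by a total function whose values outside \<open>\<Omega>\<close> are
  irrelevant. Holomorphic: Frechet differentiable with complex linear derivative.\<close>

definition holomorphic_Cn :: "(complex^'n \<Rightarrow> complex) \<Rightarrow> (complex^'n) set \<Rightarrow> bool" where
  "holomorphic_Cn f \<Omega> \<longleftrightarrow>
     (\<forall>z\<in>\<Omega>. \<exists>f'. (f has_derivative f') (at z) \<and> (\<forall>c v. f' (c *s v) = c * f' v))"

definition bergman_space :: "(complex^'n) set \<Rightarrow> (complex^'n \<Rightarrow> complex) set" where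
  "bergman_space \<Omega> =
     {f. holomorphic_Cn f \<Omega> \<and> set_integrable lborel \<Omega> (\<lambda>z. (norm (f z))\<^sup>2)}"

text \<open>The reproducing kernel. That \<open>cnj (K z w)\<close> is square-integrable in \<open>w\<close> makes the
  reproducing integral converge and the kernel unique on \<open>\<Omega> \<times> \<Omega>\<close>; outside \<open>\<Omega> \<times> \<Omega>\<close> it is
  set to 0 so that the definite description below is meaningful.\<close>

definition is_bergman_kernel ::
  "(complex^'n) set \<Rightarrow> (complex^'n \<Rightarrow> complex^'n \<Rightarrow> complex) \<Rightarrow> bool" where
  "is_bergman_kernel \<Omega> K \<longleftrightarrow>
     (\<forall>w\<in>\<Omega>. holomorphic_Cn (\<lambda>z. K z w) \<Omega>) \<and>
     (\<forall>z\<in>\<Omega>. (\<lambda>w. cnj (K z w)) \<in> bergman_space \<Omega>) \<and>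
     (\<forall>f\<in>bergman_space \<Omega>. \<forall>z\<in>\<Omega>. (LINT w:\<Omega>|lborel. f w * K z w) = f z) \<and>
     (\<forall>z w. z \<notin> \<Omega> \<or> w \<notin> \<Omega> \<longrightarrow> K z w = 0)"

definition bergman_kernel ::
  "(complex^'n) set \<Rightarrow> complex^'n \<Rightarrow> complex^'n \<Rightarrow> complex" where
  "bergman_kernel \<Omega> = (THE K. is_bergman_kernel \<Omega> K)"

section \<open>Bergman span\<close>

text \<open>The Wirtinger derivative \<open>\<partial>/\<partial>(cnj w\<^sub>j) = (\<partial>/\<partial>x\<^sub>j + \<i> \<partial>/\<partial>y\<^sub>j) / 2\<close>, where \<open>w\<^sub>j = x\<^sub>j + \<i> y\<^sub>j\<close>.\<close>

definition dbar :: "'n \<Rightarrow> (complex^'n \<Rightarrow> complex) \<Rightarrow> complex^'n \<Rightarrow> complex" where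
  "dbar j g w =
     (vector_derivative (\<lambda>t. g (w + t *\<^sub>R axis j 1)) (at 0) +
      \<i> * vector_derivative (\<lambda>t. g (w + t *\<^sub>R axis j \<i>)) (at 0)) / 2"

text \<open>The multi-index derivative applies \<open>dbar j\<close> exactly \<open>\<alpha> j\<close> times for every \<open>j\<close>. The index
  type carries no order, so an enumeration of it is chosen; for smooth functions, such as
  \<open>K(z, \<cdot>)\<close>, the operators commute and the choice is irrelevant.\<close>

definition index_list :: "'n::finite list" where
  "index_list = (SOME js. distinct js \<and> set js = UNIV)"

definition dbar_multi ::
  "('n::finite \<Rightarrow> nat) \<Rightarrow> (complex^'n \<Rightarrow> complex) \<Rightarrow> complex^'n \<Rightarrow> complex" where
  "dbar_multi \<alpha> g = foldr (\<lambda>j. dbar j ^^ \<alpha> j) index_list g"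

definition bergman_span :: "(complex^'n::finite) set \<Rightarrow> (complex^'n \<Rightarrow> complex) set" where
  "bergman_span \<Omega> =
     {f. \<exists>(S :: (('n \<Rightarrow> nat) \<times> (complex^'n)) set) c. finite S \<and> S \<subseteq> UNIV \<times> \<Omega> \<and>
         (\<forall>z\<in>\<Omega>. f z = (\<Sum>(\<alpha>, w0)\<in>S. c (\<alpha>, w0) * dbar_multi \<alpha> (bergman_kernel \<Omega> z) w0))}"

section \<open>Quadrature domains\<close>

definition quadrature_domain :: "(complex^'n::finite) set \<Rightarrow> bool" where
  "quadrature_domain \<Omega> \<longleftrightarrow>
     is_domain \<Omega> \<and> finite_volume \<Omega> \<and> (\<lambda>z. 1) \<in> bergman_span \<Omega>"

definition holomorphic_polynomial :: "(complex^'n::finite \<Rightarrow> complex) \<Rightarrow> bool" where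
  "holomorphic_polynomial p \<longleftrightarrow>
     (\<exists>(A :: ('n \<Rightarrow> nat) set) a. finite A \<and> p = (\<lambda>z. \<Sum>\<alpha>\<in>A. a \<alpha> * (\<Prod>j\<in>UNIV. (z $ j) ^ \<alpha> j)))"

definition QDP :: "(complex^'n::finite) set \<Rightarrow> bool" where
  "QDP \<Omega> \<longleftrightarrow>
     quadrature_domain \<Omega> \<and> (\<forall>p. holomorphic_polynomial p \<longrightarrow> p \<in> bergman_span \<Omega>)"

section \<open>Planar domains and products\<close>

text \<open>The identification of \<open>\<complex>\<close> with \<open>\<complex>\<^sup>1\<close>.\<close>

definition planar :: "complex set \<Rightarrow> (complex^1) set" where
  "planar D = {z. z $ 1 \<in> D}"

definition cartesian_product :: "('n \<Rightarrow> complex set) \<Rightarrow> (complex^'n) set" where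
  "cartesian_product \<Omega> = {z. \<forall>j. z $ j \<in> \<Omega> j}"

end

theory Submission
  imports Defs "HOL-Complex_Analysis.Cauchy_Integral_Formula"
begin

text \<open>The reproducing element of a planar domain at a point is a multiple of the function of
  least norm taking the value 1 there, which exists by the parallelogram law and the area mean value
  inequality. By Fubini the Bergman kernel of a product domain is the product of the planar
  kernels, so the Bergman span of the product is spanned by products of functions in the planar
  Bergman spans. Expanding products of the planar representations of powers gives all monomials;
  conversely, fixing all variables but one in a representation of a power of that variable gives
  a planar representation.\<close>

section \<open>Rotations and the area mean value inequality\<close>

text \<open>The kernel is a definite description, so nothing can be said about it before a kernel
  has been constructed. This is done once for an arbitrary finite product of planar domains;
  \<open>complex^1\<close> is the case of one factor, so the planar span is covered by the same
  result. The obstacle is that a square-integrable holomorphic function on the product has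
  square-integrable slices only almost everywhere, while the reproducing property is claimed at a
  prescribed point. The area mean value inequality closes this gap: in one variable it bounds the
  value at a prescribed point by an integral over the whole slice, so coordinates can be frozen one
  at a time without losing square integrability. On a single planar domain the same inequality
  bounds point evaluations and turns convergence in norm into locally uniform convergence. It is
  obtained by integrating a circle estimate over a disc, with rotation invariance of Lebesgue
  measure in place of polar coordinates. In the construction of the kernel, finite area makes the
  constant 1 a competitor in the extremal problem.\<close>

lemma lborel_complex_eq_distr:
  "(lborel :: complex measure) = distr (lborel \<Otimes>\<^sub>M lborel) borel (\<lambda>(x, y). Complex x y)"
proof (rule lborel_eqI)
  fix l u :: complex
  assume "\<And>b. b \<in> Basis \<Longrightarrow> l \<bullet> b \<le> u \<bullet> b"
  from this[of 1] this[of \<i>] have le: "Re l \<le> Re u" "Im l \<le> Im u"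
    by (simp_all add: Basis_complex_def)
  have [measurable]: "(\<lambda>(x, y). Complex x y) \<in> borel_measurable (lborel \<Otimes>\<^sub>M lborel)"
    by (auto simp: lborel_prod case_prod_beta complex_eq_iff Complex_eq
        intro!: borel_measurable_continuous_onI continuous_intros)
  have "(\<lambda>(x, y). Complex x y) -` box l u = {Re l<..<Re u} \<times> {Im l<..<Im u}"
    by (auto simp: box_def Basis_complex_def)
  then have "emeasure (distr (lborel \<Otimes>\<^sub>M lborel) borel (\<lambda>(x, y). Complex x y)) (box l u) =
      emeasure (lborel \<Otimes>\<^sub>M lborel) ({Re l<..<Re u} \<times> {Im l<..<Im u})"
    by (subst emeasure_distr) (auto simp: space_pair_measure)
  also have "\<dots> = ennreal (Re u - Re l) * ennreal (Im u - Im l)"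
    using le by (subst lborel.emeasure_pair_measure_Times) auto
  also have "\<dots> = (\<Prod>b\<in>Basis. (u - l) \<bullet> b)"
    using le by (simp add: Basis_complex_def ennreal_mult[symmetric])
  finally show "emeasure (distr (lborel \<Otimes>\<^sub>M lborel) borel (\<lambda>(x, y). Complex x y)) (box l u) =
      (\<Prod>b\<in>Basis. (u - l) \<bullet> b)" .
qed simp

lemma borel_measurable_Complex [measurable (raw)]:
  assumes "f \<in> borel_measurable M" "g \<in> borel_measurable M"
  shows "(\<lambda>x. Complex (f x) (g x)) \<in> borel_measurable M"
  unfolding Complex_eq using assms by measurable

lemma nn_integral_complex_iterated:
  assumes [measurable]: "f \<in> borel_measurable borel"
  shows "(\<integral>\<^sup>+z. f z \<partial>(lborel :: complex measure)) =
    (\<integral>\<^sup>+y. \<integral>\<^sup>+x. f (Complex x y) \<partial>lborel \<partial>lborel)"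
proof -
  have "(\<integral>\<^sup>+z. f z \<partial>(lborel :: complex measure)) =
      (\<integral>\<^sup>+p. f (Complex (fst p) (snd p)) \<partial>(lborel \<Otimes>\<^sub>M lborel))"
    by (subst lborel_complex_eq_distr, subst nn_integral_distr)
      (auto simp: case_prod_beta)
  also have "\<dots> = (\<integral>\<^sup>+y. \<integral>\<^sup>+x. f (Complex x y) \<partial>lborel \<partial>lborel)"
    by (subst lborel_pair.nn_integral_snd[symmetric]) auto
  finally show ?thesis .
qed

text \<open>The rotation splits into two one-dimensional affine substitutions: with \<open>y\<close>
  fixed, \<open>x\<close> is replaced by \<open>s = a * x - b * y\<close>, the real part of
  \<open>u * z\<close>; then, with \<open>s\<close> fixed, \<open>y\<close> is replaced by the
  imaginary part \<open>t = (b * s + y) / a\<close>. The Jacobian factors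
  \<open>\<bar>a\<bar>\<close> and \<open>1 / \<bar>a\<bar>\<close> cancel. Division by
  \<open>a\<close> is the reason for excluding \<open>Re u = 0\<close>.\<close>

lemma nn_integral_rotate_aux:
  fixes u :: complex
  assumes [measurable]: "f \<in> borel_measurable borel" and u: "norm u = 1" "Re u \<noteq> 0"
  shows "(\<integral>\<^sup>+z. f (u * z) \<partial>lborel) = (\<integral>\<^sup>+z. f z \<partial>lborel)"
proof -
  define a b where "a = Re u" and "b = Im u"
  have a: "a \<noteq> 0" and ab: "a * a + b * b = 1" and u_eq: "u = Complex a b"
    using u unfolding a_def b_def
    by (auto simp: cmod_def real_sqrt_eq_1_iff power2_eq_square)
  have sub: "\<bar>a\<bar> * (\<integral>\<^sup>+x. f (u * Complex x y) \<partial>lborel) =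
      (\<integral>\<^sup>+s. f (Complex s ((b * s + y) / a)) \<partial>lborel)" for y
  proof -
    have "u * Complex x y = Complex (- b * y + a * x) ((b * (- b * y + a * x) + y) / a)" for x
    proof -
      have "(b * (- b * y + a * x) + y) / a = ((1 - b * b) * y + a * b * x) / a"
        by (simp add: algebra_simps)
      also have "\<dots> = b * x + a * y"
        using a by (simp add: ab[symmetric] field_simps)
      finally show ?thesis
        by (simp add: u_eq complex_eq_iff algebra_simps)
    qed
    then show ?thesis
      by (subst nn_integral_real_affine[of "\<lambda>s. f (Complex s ((b * s + y) / a))" a "- b * y"])
        (simp_all add: a)
  qed
  have sub': "(\<integral>\<^sup>+y. f (Complex s ((b * s + y) / a)) \<partial>lborel) =
      \<bar>a\<bar> * (\<integral>\<^sup>+t. f (Complex s t) \<partial>lborel)" for s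
  proof -
    have "(\<integral>\<^sup>+t. f (Complex s t) \<partial>lborel) =
        ennreal \<bar>1 / a\<bar> * (\<integral>\<^sup>+y. f (Complex s ((b * s + y) / a)) \<partial>lborel)"
      by (subst nn_integral_real_affine[of "\<lambda>t. f (Complex s t)" "1 / a" "b * s / a"])
        (simp_all add: a add_divide_distrib)
    then have "ennreal \<bar>a\<bar> * (\<integral>\<^sup>+t. f (Complex s t) \<partial>lborel) =
        ennreal (\<bar>a\<bar> * \<bar>1 / a\<bar>) * (\<integral>\<^sup>+y. f (Complex s ((b * s + y) / a)) \<partial>lborel)"
      by (simp only: ennreal_mult' abs_ge_zero mult.assoc)
    then show ?thesis
      using a by (simp add: abs_mult[symmetric])
  qed
  have "ennreal \<bar>a\<bar> * (\<integral>\<^sup>+z. f (u * z) \<partial>lborel) =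
      (\<integral>\<^sup>+y. \<integral>\<^sup>+s. f (Complex s ((b * s + y) / a)) \<partial>lborel \<partial>lborel)"
    by (subst nn_integral_complex_iterated) (simp_all add: nn_integral_cmult[symmetric] sub)
  also have "\<dots> = (\<integral>\<^sup>+s. \<integral>\<^sup>+y. f (Complex s ((b * s + y) / a)) \<partial>lborel \<partial>lborel)"
    by (rule lborel_pair.Fubini') measurable
  also have "\<dots> = ennreal \<bar>a\<bar> * (\<integral>\<^sup>+s. \<integral>\<^sup>+t. f (Complex s t) \<partial>lborel \<partial>lborel)"
    by (simp add: sub' nn_integral_cmult)
  also have "(\<integral>\<^sup>+s. \<integral>\<^sup>+t. f (Complex s t) \<partial>lborel \<partial>lborel) = (\<integral>\<^sup>+z. f z \<partial>lborel)"
    by (subst nn_integral_complex_iterated, simp, rule lborel_pair.Fubini') measurable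
  finally show ?thesis
    using a by (simp add: ennreal_mult_cancel_left)
qed

text \<open>If \<open>Re u = 0\<close>, the rotation is performed as two rotations by a square root
  \<open>v\<close> of \<open>u\<close>. Were \<open>Re v = 0\<close>, then \<open>u\<close> would be
  real as well as purely imaginary, hence 0.\<close>

lemma nn_integral_rotate:
  fixes u :: complex
  assumes [measurable]: "f \<in> borel_measurable borel" and u: "norm u = 1"
  shows "(\<integral>\<^sup>+z. f (u * z) \<partial>lborel) = (\<integral>\<^sup>+z. f z \<partial>lborel)"
proof (cases "Re u = 0")
  case False
  then show ?thesis using nn_integral_rotate_aux assms by blast
next
  case True
  define v where "v = csqrt u"
  have vv: "v * v = u" unfolding v_def by (metis power2_csqrt power2_eq_square)
  then have v1: "norm v = 1"
    using u by (metis norm_mult norm_ge_zero mult_1 abs_square_eq_1 power2_eq_square abs_of_nonneg)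
  have "Re v \<noteq> 0"
  proof
    assume "Re v = 0"
    then have "Re u = - (Im v)\<^sup>2" "Im u = 0" using vv by (auto simp: power2_eq_square)
    with True u show False by (simp add: cmod_def)
  qed
  then have "(\<integral>\<^sup>+z. f (v * (v * z)) \<partial>lborel) = (\<integral>\<^sup>+z. f z \<partial>lborel)"
    using v1 nn_integral_rotate_aux[of "\<lambda>z. f (v * z)" v] nn_integral_rotate_aux[of f v] by simp
  then show ?thesis by (simp add: vv[symmetric] mult.assoc)
qed

text \<open>The Cauchy formula is applied to the square of \<open>g\<close>, which is again
  holomorphic. The triangle inequality for integrals then yields the bound on squared norms at once,
  with no appeal to convexity.\<close>

lemma square_norm_le_circle_average:
  fixes g :: "complex \<Rightarrow> complex"
  assumes g: "g holomorphic_on ball z r" and y: "norm y < r"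
  shows "ennreal ((norm (g z))\<^sup>2) \<le>
    (\<integral>\<^sup>+\<theta>. indicator {0..1} \<theta> * ennreal ((norm (g (z + exp (2 * of_real pi * \<i> * of_real \<theta>) * y)))\<^sup>2) \<partial>lborel)"
proof -
  define e where "e = (\<lambda>\<theta>. exp (2 * of_real pi * \<i> * of_real \<theta>) :: complex)"
  define h where "h = (\<lambda>\<zeta>. (g (z + \<zeta> * y))\<^sup>2)"
  have e0 [simp]: "e \<theta> \<noteq> 0" for \<theta> by (simp add: e_def)
  have in_ball: "z + \<zeta> * y \<in> ball z r" if "norm \<zeta> \<le> 1" for \<zeta>
  proof -
    have "norm (\<zeta> * y) \<le> 1 * norm y"
      unfolding norm_mult using that by (intro mult_right_mono) auto
    then show ?thesis using y by (simp add: dist_norm)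
  qed
  have h: "h holomorphic_on cball 0 1"
    unfolding h_def using in_ball
    by (intro holomorphic_intros holomorphic_on_compose_gen[OF _ g, unfolded o_def]) auto
  have "((\<lambda>\<zeta>. h \<zeta> / (\<zeta> - 0)) has_contour_integral (2 * of_real pi * \<i> * h 0)) (circlepath 0 1)"
    by (rule Cauchy_integral_circlepath_simple[OF h]) simp
  \<comment> \<open>Along the unit circle the derivative of the path is \<open>2 * pi * \<i>\<close>
    times the point itself, which cancels the denominator \<open>\<zeta>\<close>.\<close>
  then have "((\<lambda>\<theta>. 2 * of_real pi * \<i> * h (e \<theta>)) has_integral 2 * of_real pi * \<i> * h 0) {0..1}"
    unfolding has_contour_integral
    by (rule has_integral_eq[rotated])
      (simp only: vector_derivative_circlepath, simp add: circlepath e_def)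
  then have "((\<lambda>\<theta>. (1 / (2 * of_real pi * \<i>)) * (2 * of_real pi * \<i> * h (e \<theta>))) has_integral
      (1 / (2 * of_real pi * \<i>)) * (2 * of_real pi * \<i> * h 0)) {0..1}"
    by (rule has_integral_mult_right)
  then have int: "((\<lambda>\<theta>. h (e \<theta>)) has_integral h 0) {0..1}"
    by simp
  have "continuous_on {0..1} (\<lambda>\<theta>. h (e \<theta>))"
    by (rule continuous_on_compose2[OF holomorphic_on_imp_continuous_on[OF h]])
      (auto simp: e_def intro!: continuous_intros)
  then have si: "set_integrable lborel {0..1} (\<lambda>\<theta>. h (e \<theta>))"
    by (rule borel_integrable_atLeastAtMost')
  have "(LINT \<theta>:{0..1}|lborel. h (e \<theta>)) = h 0"
    using set_borel_integral_eq_integral(2)[OF si] int by (simp add: integral_unique)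
  then have "ennreal (norm (h 0)) \<le> (\<integral>\<^sup>+\<theta>. norm (indicator {0..1} \<theta> *\<^sub>R h (e \<theta>)) \<partial>lborel)"
    using integral_norm_bound_ennreal[OF si[unfolded set_integrable_def]]
    by (simp add: set_lebesgue_integral_def)
  also have "\<dots> = (\<integral>\<^sup>+\<theta>. indicator {0..1} \<theta> * ennreal ((norm (g (z + e \<theta> * y)))\<^sup>2) \<partial>lborel)"
    by (intro nn_integral_cong) (simp add: h_def norm_power indicator_def)
  finally show ?thesis
    by (simp add: h_def norm_power e_def)
qed

text \<open>The circle estimate is integrated over all \<open>y\<close> in the disc. After
  exchanging the integrals over \<open>y\<close> and \<open>\<theta>\<close>, rotation invariance
  makes the inner integral independent of \<open>\<theta>\<close>, and the average over
  \<open>{0..1}\<close> disappears.\<close>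

lemma area_mean_value_inequality:
  fixes g :: "complex \<Rightarrow> complex"
  assumes g: "g holomorphic_on ball z r"
  shows "emeasure lborel (ball 0 r :: complex set) * ennreal ((norm (g z))\<^sup>2) \<le>
    (\<integral>\<^sup>+x\<in>ball z r. ennreal ((norm (g x))\<^sup>2) \<partial>lborel)"
proof -
  define e where "e = (\<lambda>\<theta>. exp (2 * of_real pi * \<i> * of_real \<theta>) :: complex)"
  \<comment> \<open>Extension by zero gives a Borel function on the whole plane, as Tonelli and
    rotation invariance require; \<open>g\<close> itself may be arbitrary off the disc.\<close>
  define \<phi> where "\<phi> = (\<lambda>x. ennreal (norm (indicator (ball z r) x *\<^sub>R g x) ^ 2))"
  have [measurable]: "(\<lambda>x. indicator (ball z r) x *\<^sub>R g x) \<in> borel_measurable borel"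
    using holomorphic_on_imp_continuous_on[OF g]
    by (intro borel_measurable_continuous_on_indicator) auto
  have [measurable]: "\<phi> \<in> borel_measurable borel"
    unfolding \<phi>_def by measurable
  have [measurable]: "e \<in> borel_measurable borel"
    unfolding e_def by (intro borel_measurable_continuous_onI continuous_intros)
  have norm_e [simp]: "norm (e \<theta>) = 1" for \<theta>
    by (simp add: e_def)
  have rot: "(\<integral>\<^sup>+y. \<phi> (z + e \<theta> * y) \<partial>lborel) = (\<integral>\<^sup>+x. \<phi> x \<partial>lborel)" for \<theta>
  proof -
    have "(\<integral>\<^sup>+y. \<phi> (z + e \<theta> * y) \<partial>lborel) = (\<integral>\<^sup>+y. \<phi> (z + y) \<partial>lborel)"
      using nn_integral_rotate[of "\<lambda>y. \<phi> (z + y)" "e \<theta>"] by simp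
    also have "\<dots> = (\<integral>\<^sup>+x. \<phi> x \<partial>distr lborel borel ((+) z))"
      by (subst nn_integral_distr) auto
    finally show ?thesis by (simp add: lborel_distr_plus)
  qed
  have "emeasure lborel (ball 0 r :: complex set) * ennreal ((norm (g z))\<^sup>2) =
      (\<integral>\<^sup>+y. indicator (ball 0 r) y * ennreal ((norm (g z))\<^sup>2) \<partial>(lborel :: complex measure))"
    by (subst nn_integral_multc) (auto intro!: borel_measurable_indicator)
  also have "\<dots> \<le> (\<integral>\<^sup>+y. \<integral>\<^sup>+\<theta>. indicator {0..1} \<theta> * \<phi> (z + e \<theta> * y) \<partial>lborel \<partial>lborel)"
  proof (rule nn_integral_mono)
    fix y :: complex
    show "indicator (ball 0 r) y * ennreal ((norm (g z))\<^sup>2) \<le>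
        (\<integral>\<^sup>+\<theta>. indicator {0..1} \<theta> * \<phi> (z + e \<theta> * y) \<partial>lborel)"
    proof (cases "norm y < r")
      case True
      then have "\<phi> (z + e \<theta> * y) = ennreal ((norm (g (z + e \<theta> * y)))\<^sup>2)" for \<theta>
        by (simp add: \<phi>_def dist_norm norm_mult)
      then show ?thesis
        using square_norm_le_circle_average[OF g True] True by (simp add: e_def)
    qed simp
  qed
  also have "\<dots> = (\<integral>\<^sup>+\<theta>. \<integral>\<^sup>+y. indicator {0..1} \<theta> * \<phi> (z + e \<theta> * y) \<partial>lborel \<partial>lborel)"
    by (rule pair_sigma_finite.Fubini')
      (auto intro!: pair_sigma_finite.intro sigma_finite_lborel)
  also have "\<dots> = (\<integral>\<^sup>+\<theta>. indicator {0..1} \<theta> * (\<integral>\<^sup>+x. \<phi> x \<partial>lborel) \<partial>(lborel :: real measure))"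
    by (simp add: nn_integral_cmult rot)
  also have "\<dots> = (\<integral>\<^sup>+x. \<phi> x \<partial>lborel)"
    by (simp add: nn_integral_multc)
  also have "\<dots> = (\<integral>\<^sup>+x\<in>ball z r. ennreal ((norm (g x))\<^sup>2) \<partial>lborel)"
    by (intro nn_integral_cong) (simp add: \<phi>_def indicator_def)
  finally show ?thesis .
qed

text \<open>Counterpart of \<open>bergman_space\<close> over \<open>complex\<close> instead of
  \<open>complex^1\<close>, so that one-variable holomorphy applies directly.\<close>

definition planar_bergman_space :: "complex set \<Rightarrow> (complex \<Rightarrow> complex) set" where
  "planar_bergman_space D =
     {f. f holomorphic_on D \<and> set_integrable lborel D (\<lambda>z. (norm (f z))\<^sup>2)}"

text \<open>Point evaluation is continuous for the Bergman norm, uniformly over points at a fixed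
  distance from the complement. This serves twice: to make norm-Cauchy sequences locally uniformly
  Cauchy, and to show that an extremal function has positive norm.\<close>

lemma planar_bergman_space_norm_ge:
  assumes D: "open D" and f: "f \<in> planar_bergman_space D" and b: "ball z r \<subseteq> D"
  shows "measure lborel (ball 0 r :: complex set) * (norm (f z))\<^sup>2 \<le> (LINT x:D|lborel. (norm (f x))\<^sup>2)"
proof -
  have si: "set_integrable lborel D (\<lambda>z. (norm (f z))\<^sup>2)" and hol: "f holomorphic_on ball z r"
    using f b by (auto simp: planar_bergman_space_def intro: holomorphic_on_subset)
  have "ennreal (measure lborel (ball 0 r :: complex set) * (norm (f z))\<^sup>2) =
      emeasure lborel (ball 0 r :: complex set) * ennreal ((norm (f z))\<^sup>2)"
    by (subst emeasure_eq_ennreal_measure)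
      (use emeasure_lborel_ball_finite[of "0::complex" r] in \<open>auto simp: ennreal_mult'\<close>)
  also have "\<dots> \<le> (\<integral>\<^sup>+x\<in>ball z r. ennreal ((norm (f x))\<^sup>2) \<partial>lborel)"
    by (rule area_mean_value_inequality[OF hol])
  also have "\<dots> \<le> (\<integral>\<^sup>+x. ennreal (indicator D x *\<^sub>R (norm (f x))\<^sup>2) \<partial>lborel)"
    using b by (intro nn_integral_mono) (auto simp: indicator_def)
  also have "\<dots> = ennreal (LINT x:D|lborel. (norm (f x))\<^sup>2)"
    unfolding set_lebesgue_integral_def
    using si by (intro nn_integral_eq_integral) (auto simp: set_integrable_def)
  finally show ?thesis
    by (subst (asm) ennreal_le_iff) (auto simp: set_lebesgue_integral_def intro!: integral_nonneg_AE)
qed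

section \<open>Reproducing elements of planar domains\<close>

lemma set_borel_measurable_holomorphic:
  assumes "open D" "f holomorphic_on D"
  shows "set_borel_measurable lborel D f"
  using assms holomorphic_on_imp_continuous_on[of f D] unfolding set_borel_measurable_def
  by (simp add: borel_measurable_continuous_on_indicator)

text \<open>The integrand is dominated pointwise through
  \<open>a * b \<le> a\<^sup>2 + b\<^sup>2\<close>.\<close>

lemma set_integrable_times_cnj:
  fixes f g :: "'a \<Rightarrow> complex"
  assumes f: "set_borel_measurable M D f" "set_integrable M D (\<lambda>z. (norm (f z))\<^sup>2)"
    and g: "set_borel_measurable M D g" "set_integrable M D (\<lambda>z. (norm (g z))\<^sup>2)"
  shows "set_integrable M D (\<lambda>z. f z * cnj (g z))"
proof -
  have "set_integrable M D (\<lambda>z. (norm (f z))\<^sup>2 + (norm (g z))\<^sup>2)"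
    using f g by (intro set_integral_add) auto
  then show ?thesis
    unfolding set_integrable_def
  proof (rule Bochner_Integration.integrable_bound)
    have [measurable]: "cnj \<in> borel_measurable borel"
      by (intro borel_measurable_continuous_onI continuous_intros)
    have "(\<lambda>x. (indicator D x *\<^sub>R f x) * cnj (indicator D x *\<^sub>R g x)) \<in> borel_measurable M"
      using f(1) g(1) unfolding set_borel_measurable_def by measurable
    moreover have "(\<lambda>x. (indicator D x *\<^sub>R f x) * cnj (indicator D x *\<^sub>R g x)) =
        (\<lambda>x. indicator D x *\<^sub>R (f x * cnj (g x)))"
      by (auto simp: indicator_def)
    ultimately show "(\<lambda>x. indicator D x *\<^sub>R (f x * cnj (g x))) \<in> borel_measurable M" by simp
    have "a * b \<le> a\<^sup>2 + b\<^sup>2" if "0 \<le> a" "0 \<le> b" for a b :: real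
      using sum_squares_bound[of a b] mult_nonneg_nonneg[OF that] by simp
    then show "AE x in M. norm (indicator D x *\<^sub>R (f x * cnj (g x)))
        \<le> norm (indicator D x *\<^sub>R ((norm (f x))\<^sup>2 + (norm (g x))\<^sup>2))"
      by (intro AE_I2) (auto simp: indicator_def norm_mult)
  qed
qed

lemma planar_bergman_space_scale:
  assumes "f \<in> planar_bergman_space D"
  shows "(\<lambda>z. c * f z) \<in> planar_bergman_space D"
  using assms by (auto simp: planar_bergman_space_def norm_mult power_mult_distrib
      intro!: holomorphic_intros)

lemma norm_square_add:
  "(norm (a + b))\<^sup>2 = (norm a)\<^sup>2 + (norm b)\<^sup>2 + 2 * Re (a * cnj b)" for a b :: complex
  unfolding cmod_power2 by (simp add: power2_eq_square algebra_simps)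

lemma planar_norm_scale:
  fixes c :: complex
  shows "(LINT z:D|lborel. (norm (c * f z))\<^sup>2) = (norm c)\<^sup>2 * (LINT z:D|lborel. (norm (f z))\<^sup>2)"
  unfolding norm_mult power_mult_distrib by simp

lemma planar_norm_nonneg: "0 \<le> (LINT z:D|lborel. (norm (f z))\<^sup>2)"
  by (auto simp: set_lebesgue_integral_def intro!: integral_nonneg_AE)

context
  fixes D :: "complex set"
  assumes D: "open D"
begin

lemma planar_times_cnj_integrable:
  assumes "f \<in> planar_bergman_space D" "g \<in> planar_bergman_space D"
  shows "set_integrable lborel D (\<lambda>z. f z * cnj (g z))"
  using assms D set_borel_measurable_holomorphic
  by (intro set_integrable_times_cnj) (auto simp: planar_bergman_space_def)

lemma
  assumes f: "f \<in> planar_bergman_space D" and g: "g \<in> planar_bergman_space D"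
  shows planar_bergman_space_add: "(\<lambda>z. f z + g z) \<in> planar_bergman_space D"
    and planar_norm_add: "(LINT z:D|lborel. (norm (f z + g z))\<^sup>2) =
      (LINT z:D|lborel. (norm (f z))\<^sup>2) + (LINT z:D|lborel. (norm (g z))\<^sup>2) +
      2 * Re (LINT z:D|lborel. f z * cnj (g z))"
proof -
  have i: "set_integrable lborel D (\<lambda>z. (norm (f z))\<^sup>2)" "set_integrable lborel D (\<lambda>z. (norm (g z))\<^sup>2)"
    using f g by (auto simp: planar_bergman_space_def)
  have c: "set_integrable lborel D (\<lambda>z. f z * cnj (g z))"
    by (rule planar_times_cnj_integrable[OF f g])
  define p where "p = (\<lambda>z. f z * cnj (g z))"
  have sq: "(norm (f z + g z))\<^sup>2 = (norm (f z))\<^sup>2 + (norm (g z))\<^sup>2 + 2 * Re (p z)" for z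
    by (simp only: norm_square_add p_def)
  have eq: "indicator D z *\<^sub>R Re (p z) = Re (indicator D z *\<^sub>R p z)" for z
    by (simp add: indicator_def)
  have r: "set_integrable lborel D (\<lambda>z. 2 * Re (p z))"
    using integrable_Re[OF c[folded p_def, unfolded set_integrable_def]]
    by (intro set_integrable_mult_right) (simp only: set_integrable_def eq)
  have "set_integrable lborel D (\<lambda>z. (norm (f z + g z))\<^sup>2)"
    unfolding sq by (intro set_integral_add(1) i r)
  then show "(\<lambda>z. f z + g z) \<in> planar_bergman_space D"
    using f g by (auto simp: planar_bergman_space_def intro!: holomorphic_intros)
  have "(LINT z:D|lborel. Re (p z)) = Re (LINT z:D|lborel. p z)"
    unfolding set_lebesgue_integral_def eq
    using c by (intro integral_Re) (simp add: set_integrable_def p_def)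
  then show "(LINT z:D|lborel. (norm (f z + g z))\<^sup>2) =
      (LINT z:D|lborel. (norm (f z))\<^sup>2) + (LINT z:D|lborel. (norm (g z))\<^sup>2) +
      2 * Re (LINT z:D|lborel. f z * cnj (g z))"
    unfolding sq p_def[symmetric]
    by (simp add: set_integral_add(2) set_integral_add(1) i r)
qed

text \<open>First variation: every \<open>g + t * h\<close> still takes the value 1 at
  \<open>w\<close>, so it cannot have smaller norm than \<open>g\<close>. If the inner product
  \<open>c\<close> were nonzero, a small \<open>t\<close> in the right direction would lower the
  norm.\<close>

lemma planar_extremal_orthogonal:
  assumes g: "g \<in> planar_bergman_space D" "g w = 1"
    and min: "\<And>f. f \<in> planar_bergman_space D \<Longrightarrow> f w = 1 \<Longrightarrow>
      (LINT z:D|lborel. (norm (g z))\<^sup>2) \<le> (LINT z:D|lborel. (norm (f z))\<^sup>2)"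
    and h: "h \<in> planar_bergman_space D" "h w = 0"
  shows "(LINT z:D|lborel. h z * cnj (g z)) = 0"
proof (rule ccontr)
  define c where "c = (LINT z:D|lborel. h z * cnj (g z))"
  define H where "H = (LINT z:D|lborel. (norm (h z))\<^sup>2)"
  assume "(LINT z:D|lborel. h z * cnj (g z)) \<noteq> 0"
  then have c: "norm c > 0" by (simp add: c_def)
  have H: "H \<ge> 0" unfolding H_def by (rule planar_norm_nonneg)
  have bound: "2 * \<epsilon> * (norm c)\<^sup>2 \<le> \<epsilon>\<^sup>2 * (norm c)\<^sup>2 * H" if "\<epsilon> > 0" for \<epsilon> :: real
  proof -
    \<comment> \<open>The factor \<open>cnj c\<close> makes the cross term \<open>t * c\<close> real
      and negative.\<close>
    define t where "t = - of_real \<epsilon> * cnj c"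
    have "(LINT z:D|lborel. (norm (g z))\<^sup>2) \<le> (LINT z:D|lborel. (norm (t * h z + g z))\<^sup>2)"
      using g h by (intro min planar_bergman_space_add planar_bergman_space_scale) auto
    also have "\<dots> = (norm t)\<^sup>2 * H + (LINT z:D|lborel. (norm (g z))\<^sup>2) +
        2 * Re (LINT z:D|lborel. (t * h z) * cnj (g z))"
      using g h by (subst planar_norm_add) (auto simp: planar_norm_scale H_def intro: planar_bergman_space_scale)
    also have "(LINT z:D|lborel. (t * h z) * cnj (g z)) = t * c"
      by (simp add: c_def mult.assoc)
    also have "Re (t * c) = - \<epsilon> * (norm c)\<^sup>2"
      by (simp only: t_def cmod_power2) (simp add: power2_eq_square algebra_simps)
    also have "(norm t)\<^sup>2 = \<epsilon>\<^sup>2 * (norm c)\<^sup>2"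
      by (simp add: t_def norm_mult power_mult_distrib)
    finally show ?thesis by simp
  qed
  \<comment> \<open>Small enough for the linear term to beat the quadratic one; the summand 1 keeps
    the denominator positive when \<open>H = 0\<close>.\<close>
  define \<epsilon> where "\<epsilon> = 1 / (H + 1)"
  have \<epsilon>: "\<epsilon> > 0" using H by (simp add: \<epsilon>_def)
  have "\<epsilon> * H < 2" using H by (simp add: \<epsilon>_def field_simps)
  then have "(\<epsilon> * (norm c)\<^sup>2) * (\<epsilon> * H) < (\<epsilon> * (norm c)\<^sup>2) * 2"
    using \<epsilon> c by (intro mult_strict_left_mono) auto
  with bound[OF \<epsilon>] show False by (simp add: power2_eq_square mult_ac)
qed

text \<open>A minimising sequence is Cauchy in norm by the parallelogram law, hence locally
  uniformly Cauchy by the point evaluation bound, and its pointwise limit is holomorphic. Fatou's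
  lemma bounds the norm of the limit by the infimum, so convergence in norm to the limit never has
  to be shown.\<close>

lemma planar_extremal_exists:
  assumes fin: "emeasure lborel D < \<infinity>" and w: "w \<in> D"
  obtains g where "g \<in> planar_bergman_space D" "g w = 1"
    "\<And>f. f \<in> planar_bergman_space D \<Longrightarrow> f w = 1 \<Longrightarrow>
      (LINT z:D|lborel. (norm (g z))\<^sup>2) \<le> (LINT z:D|lborel. (norm (f z))\<^sup>2)"
proof -
  define N where "N = (\<lambda>f :: complex \<Rightarrow> complex. LINT z:D|lborel. (norm (f z))\<^sup>2)"
  define S where "S = {f \<in> planar_bergman_space D. f w = 1}"
  define d where "d = Inf (N ` S)"
  have N0: "0 \<le> N f" for f
    unfolding N_def by (rule planar_norm_nonneg)
  \<comment> \<open>The constant 1 is square integrable because \<open>D\<close> has finite area;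
    this keeps the set of competitors nonempty.\<close>
  have "(\<lambda>z. 1) \<in> S"
    using fin D by (auto simp: S_def planar_bergman_space_def set_integrable_def)
  then have ne: "N ` S \<noteq> {}" by auto
  have bdd: "bdd_below (N ` S)"
    using N0 by (intro bdd_belowI[of _ 0]) auto
  have d_le: "d \<le> N f" if "f \<in> S" for f
    unfolding d_def using that bdd by (auto intro: cInf_lower)
  have "\<exists>f\<in>S. N f < d + 1 / real (Suc n)" for n
    using cInf_lessD[OF ne, of "d + 1 / real (Suc n)"] by (auto simp: d_def)
  then obtain f where f: "\<And>n. f n \<in> S" and f_less: "\<And>n. N (f n) < d + 1 / real (Suc n)"
    by metis
  have fB: "f n \<in> planar_bergman_space D" for n using f by (auto simp: S_def)
  have diffB: "(\<lambda>z. f n z - f m z) \<in> planar_bergman_space D" for n m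
    using planar_bergman_space_add[OF fB planar_bergman_space_scale[OF fB], of n "-1" m] by simp
  \<comment> \<open>The midpoint of two competitors is a competitor, so its norm is at least
    \<open>d\<close>; the parallelogram law then leaves only the excesses of \<open>N (f n)\<close>
    and \<open>N (f m)\<close> over \<open>d\<close>.\<close>
  have cauchy: "N (\<lambda>z. f n z - f m z) \<le> 2 / real (Suc n) + 2 / real (Suc m)" for n m
  proof -
    have S: "(\<lambda>z. (1/2) * (f n z + f m z)) \<in> S"
      using f[of n] f[of m] planar_bergman_space_scale[OF planar_bergman_space_add[OF fB fB], of "1/2" n m]
      by (simp add: S_def)
    have "N (\<lambda>z. f n z + f m z) = N (f n) + N (f m) + 2 * Re (LINT z:D|lborel. f n z * cnj (f m z))"
      unfolding N_def by (rule planar_norm_add[OF fB fB])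
    moreover have "N (\<lambda>z. f n z - f m z) = N (f n) + N (f m) - 2 * Re (LINT z:D|lborel. f n z * cnj (f m z))"
      using planar_norm_add[OF fB planar_bergman_space_scale[OF fB], of n "-1" m]
      by (simp add: N_def set_lebesgue_integral_def)
    moreover have "N (\<lambda>z. (1/2) * (f n z + f m z)) = 1/4 * N (\<lambda>z. f n z + f m z)"
      unfolding N_def by (subst planar_norm_scale) (simp add: norm_divide power_divide)
    ultimately have "N (\<lambda>z. f n z - f m z) = 2 * N (f n) + 2 * N (f m) - 4 * N (\<lambda>z. (1/2) * (f n z + f m z))"
      by simp
    then show ?thesis using d_le[OF S] f_less[of n] f_less[of m] by simp
  qed
  have local_limit: "\<exists>\<rho>>0. cball z \<rho> \<subseteq> D \<and> uniform_limit (cball z \<rho>) f (\<lambda>x. lim (\<lambda>n. f n x)) sequentially"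
    if z: "z \<in> D" for z
  proof -
    obtain r where r: "r > 0" "ball z r \<subseteq> D" using D z openE by blast
    \<comment> \<open>Half the radius, so that discs of radius \<open>\<rho>\<close> around points
      of \<open>cball z \<rho>\<close> stay inside \<open>ball z r\<close> and one constant
      \<open>C\<close> serves all these points.\<close>
    define \<rho> where "\<rho> = r / 2"
    have \<rho>: "\<rho> > 0" "\<rho> < r" using r by (auto simp: \<rho>_def)
    define C where "C = measure lborel (ball 0 \<rho> :: complex set)"
    have C: "C > 0" unfolding C_def using \<rho> by (simp add: content_ball_pos)
    have "uniformly_Cauchy_on (cball z \<rho>) f"
    proof (rule uniformly_Cauchy_onI)
      fix \<epsilon> :: real assume \<epsilon>: "\<epsilon> > 0"
      \<comment> \<open>Beyond \<open>M\<close> the two excess terms add up to at most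
        \<open>4 / M\<close>, which has to lie below \<open>C * \<epsilon>\<^sup>2\<close>.\<close>
      obtain M where M: "real M > 4 / (C * \<epsilon>\<^sup>2)" using reals_Archimedean2 by blast
      show "\<exists>M. \<forall>x\<in>cball z \<rho>. \<forall>m\<ge>M. \<forall>n\<ge>M. dist (f m x) (f n x) < \<epsilon>"
      proof (intro exI[of _ M] ballI allI impI)
        fix x m n assume x: "x \<in> cball z \<rho>" and mn: "m \<ge> M" "n \<ge> M"
        have M0: "real M > 0"
          using M C \<epsilon> by (smt (verit) divide_nonneg_nonneg mult_nonneg_nonneg zero_le_power2)
        have "ball x \<rho> \<subseteq> ball z r"
          using x by (auto simp: \<rho>_def) (smt (verit) dist_triangle field_sum_of_halves)
        then have "C * (norm (f m x - f n x))\<^sup>2 \<le> N (\<lambda>z. f m z - f n z)"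
          unfolding C_def N_def using r by (intro planar_bergman_space_norm_ge[OF D diffB]) auto
        also have "\<dots> \<le> 2 / real (Suc m) + 2 / real (Suc n)" by (rule cauchy)
        also have "\<dots> \<le> 2 / real M + 2 / real M"
          using mn M0 by (intro add_mono divide_left_mono) auto
        also have "\<dots> = 4 / real M" by simp
        also have "\<dots> < C * \<epsilon>\<^sup>2"
          using M M0 C \<epsilon> by (simp add: field_simps)
        finally have "(norm (f m x - f n x))\<^sup>2 < \<epsilon>\<^sup>2" using C by simp
        then show "dist (f m x) (f n x) < \<epsilon>"
          using \<epsilon> by (simp add: dist_norm power2_less_imp_less)
      qed
    qed
    then have "uniformly_convergent_on (cball z \<rho>) f" by (rule Cauchy_uniformly_convergent)
    moreover have "cball z \<rho> \<subseteq> D" using \<rho> r by auto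
    ultimately show ?thesis using \<rho> by (auto simp: uniformly_convergent_uniform_limit_iff)
  qed
  define g where "g = (\<lambda>x. lim (\<lambda>n. f n x))"
  have conv: "(\<lambda>n. f n z) \<longlonglongrightarrow> g z" if "z \<in> D" for z
    using local_limit[OF that] unfolding g_def by (auto dest!: tendsto_uniform_limitI[where x = z])
  have hol: "g holomorphic_on D"
    by (rule holomorphic_uniform_sequence[OF D])
      (use fB local_limit in \<open>auto simp: planar_bergman_space_def g_def\<close>)
  have gw: "g w = 1"
    using conv[OF w] f by (intro LIMSEQ_unique[OF conv[OF w]]) (simp add: S_def)
  have meas: "(\<lambda>z. indicator D z *\<^sub>R h z) \<in> borel_measurable lborel" if "h holomorphic_on D" for h :: "complex \<Rightarrow> complex"
    using set_borel_measurable_holomorphic[OF D that] by (simp add: set_borel_measurable_def)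
  have sq: "indicator D z *\<^sub>R (norm (h z))\<^sup>2 = (norm (indicator D z *\<^sub>R h z))\<^sup>2" for z and h :: "complex \<Rightarrow> complex"
    by (simp add: indicator_def)
  have fm [measurable]: "(\<lambda>z. indicator D z *\<^sub>R f n z) \<in> borel_measurable lborel" for n
    using fB by (intro meas) (auto simp: planar_bergman_space_def)
  have gm [measurable]: "(\<lambda>z. indicator D z *\<^sub>R g z) \<in> borel_measurable lborel"
    by (rule meas[OF hol])
  \<comment> \<open>Fatou's lemma, prepared by writing the integrand of the limit as a pointwise
    \<open>liminf\<close>.\<close>
  have "(\<integral>\<^sup>+z. ennreal (indicator D z *\<^sub>R (norm (g z))\<^sup>2) \<partial>lborel) =
      (\<integral>\<^sup>+z. liminf (\<lambda>n. ennreal (indicator D z *\<^sub>R (norm (f n z))\<^sup>2)) \<partial>lborel)"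
  proof (intro nn_integral_cong)
    fix z :: complex
    have "(\<lambda>n. ennreal (indicator D z *\<^sub>R (norm (f n z))\<^sup>2)) \<longlonglongrightarrow> ennreal (indicator D z *\<^sub>R (norm (g z))\<^sup>2)"
      using conv[of z] by (cases "z \<in> D") (auto intro!: tendsto_intros)
    from lim_imp_Liminf[OF _ this]
    show "ennreal (indicator D z *\<^sub>R (norm (g z))\<^sup>2) = liminf (\<lambda>n. ennreal (indicator D z *\<^sub>R (norm (f n z))\<^sup>2))"
      by simp
  qed
  also have "\<dots> \<le> liminf (\<lambda>n. \<integral>\<^sup>+z. ennreal (indicator D z *\<^sub>R (norm (f n z))\<^sup>2) \<partial>lborel)"
    by (intro nn_integral_liminf) (simp only: sq, measurable)
  also have "\<dots> = liminf (\<lambda>n. ennreal (N (f n)))"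
  proof -
    have "(\<integral>\<^sup>+z. ennreal (indicator D z *\<^sub>R (norm (f n z))\<^sup>2) \<partial>lborel) = ennreal (N (f n))" for n
      unfolding N_def set_lebesgue_integral_def using fB[of n]
      by (intro nn_integral_eq_integral) (auto simp: planar_bergman_space_def set_integrable_def)
    then show ?thesis by simp
  qed
  also have "\<dots> \<le> liminf (\<lambda>n. ennreal (d + 1 / real (Suc n)))"
    using f_less by (intro Liminf_mono always_eventually allI ennreal_leI less_imp_le)
  also have "\<dots> = ennreal d"
  proof -
    have "(\<lambda>n. d + 1 / real (Suc n)) \<longlonglongrightarrow> d + 0"
      by (intro tendsto_add tendsto_const) (use LIMSEQ_inverse_real_of_nat in \<open>simp add: inverse_eq_divide\<close>)
    then show ?thesis by (intro lim_imp_Liminf tendsto_ennrealI) auto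
  qed
  finally have le: "(\<integral>\<^sup>+z. ennreal (indicator D z *\<^sub>R (norm (g z))\<^sup>2) \<partial>lborel) \<le> ennreal d" .
  have gi: "set_integrable lborel D (\<lambda>z. (norm (g z))\<^sup>2)"
    unfolding set_integrable_def
  proof (rule integrableI_bounded)
    show "(\<lambda>z. indicator D z *\<^sub>R (norm (g z))\<^sup>2) \<in> borel_measurable lborel"
      by (simp only: sq) measurable
    show "(\<integral>\<^sup>+z. ennreal (norm (indicator D z *\<^sub>R (norm (g z))\<^sup>2)) \<partial>lborel) < \<infinity>"
      using le by (simp add: le_less_trans)
  qed
  have "ennreal (N g) \<le> ennreal d"
    using le gi unfolding N_def set_lebesgue_integral_def set_integrable_def
    by (subst (asm) nn_integral_eq_integral) auto
  moreover have "d \<ge> 0" unfolding d_def using ne N0 by (intro cInf_greatest) auto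
  ultimately have "N g \<le> d" by simp
  show thesis
  proof (rule that[of g])
    show "g \<in> planar_bergman_space D" using hol gi by (simp add: planar_bergman_space_def)
    show "g w = 1" by fact
    show "(LINT z:D|lborel. (norm (g z))\<^sup>2) \<le> (LINT z:D|lborel. (norm (f z))\<^sup>2)"
      if "f \<in> planar_bergman_space D" "f w = 1" for f
      using \<open>N g \<le> d\<close> d_le[of f] that by (simp add: S_def N_def)
  qed
qed

text \<open>For any \<open>f\<close>, the function \<open>f - f w * g\<close> vanishes at
  \<open>w\<close> and is therefore orthogonal to the extremal \<open>g\<close>. So the inner
  product of \<open>f\<close> with \<open>g\<close> is \<open>f w\<close> times the squared norm
  \<open>n\<close> of \<open>g\<close>, and dividing \<open>g\<close> by \<open>n\<close> gives the
  reproducing element.\<close>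

lemma planar_reproducing_element_exists:
  assumes fin: "emeasure lborel D < \<infinity>" and w: "w \<in> D"
  shows "\<exists>e\<in>planar_bergman_space D.
    \<forall>f\<in>planar_bergman_space D. (LINT z:D|lborel. f z * cnj (e z)) = f w"
proof -
  obtain g where g: "g \<in> planar_bergman_space D" "g w = 1"
    and min: "\<And>f. f \<in> planar_bergman_space D \<Longrightarrow> f w = 1 \<Longrightarrow>
      (LINT z:D|lborel. (norm (g z))\<^sup>2) \<le> (LINT z:D|lborel. (norm (f z))\<^sup>2)"
    using planar_extremal_exists[OF assms] by blast
  define n where "n = (LINT z:D|lborel. (norm (g z))\<^sup>2)"
  obtain r where r: "r > 0" "ball w r \<subseteq> D" using D w openE by blast
  \<comment> \<open>Positivity of \<open>n\<close>, needed for the division: \<open>g w = 1\<close>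
    and point evaluation is bounded by the norm.\<close>
  have "0 < measure lborel (ball 0 r :: complex set) * (norm (g w))\<^sup>2"
    using r g by (simp add: content_ball_pos)
  also have "\<dots> \<le> n"
    unfolding n_def by (rule planar_bergman_space_norm_ge[OF D g(1) r(2)])
  finally have n: "n > 0" .
  have "(LINT z:D|lborel. f z * cnj ((1 / of_real n) * g z)) = f w"
    if f: "f \<in> planar_bergman_space D" for f
  proof -
    define h where "h = (\<lambda>z. f z + (- f w) * g z)"
    have h: "h \<in> planar_bergman_space D" "h w = 0"
      using planar_bergman_space_add[OF f planar_bergman_space_scale[OF g(1)], of "- f w"] g(2)
      by (simp_all add: h_def)
    have "(LINT z:D|lborel. f z * cnj (g z)) = (LINT z:D|lborel. h z * cnj (g z) + f w * (g z * cnj (g z)))"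
      by (simp add: h_def algebra_simps)
    also have "\<dots> = (LINT z:D|lborel. h z * cnj (g z)) + f w * (LINT z:D|lborel. g z * cnj (g z))"
      using planar_times_cnj_integrable[OF h(1) g(1)] planar_times_cnj_integrable[OF g(1) g(1)]
      by (subst set_integral_add) auto
    also have "(LINT z:D|lborel. h z * cnj (g z)) = 0"
      by (rule planar_extremal_orthogonal[OF g min h])
    also have "(LINT z:D|lborel. g z * cnj (g z)) = of_real n"
      unfolding n_def set_integral_complex_of_real[symmetric] complex_norm_square ..
    finally have "(LINT z:D|lborel. f z * cnj (g z)) = f w * of_real n" by simp
    moreover have "(LINT z:D|lborel. f z * cnj ((1 / of_real n) * g z)) =
        (1 / of_real n) * (LINT z:D|lborel. f z * cnj (g z))"
      by (subst set_integral_mult_right[symmetric]) (simp add: mult_ac)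
    ultimately show ?thesis using n by simp
  qed
  then show ?thesis
    by (intro bexI[OF _ planar_bergman_space_scale[OF g(1), of "1 / of_real n"]] ballI)
qed

end

section \<open>Integration over products of planar domains\<close>

interpretation lborel_product: product_sigma_finite "\<lambda>_. lborel"
  by standard

lemma vec_lambda_measurable_PiM [measurable]:
  "vec_lambda \<in> borel_measurable (\<Pi>\<^sub>M i\<in>UNIV. (lborel :: 'a::euclidean_space measure))"
proof (subst borel_measurable_euclidean_space, intro ballI)
  fix b :: "'a ^ 'b" assume "b \<in> Basis"
  then obtain i c where "b = axis i c" by (auto simp: Basis_vec_def)
  then show "(\<lambda>x. vec_lambda x \<bullet> b) \<in> borel_measurable (\<Pi>\<^sub>M i\<in>UNIV. (lborel :: 'a measure))"
    by (simp add: inner_axis)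
qed

lemma prod_Basis_vec:
  fixes f :: "'a::euclidean_space ^ 'n \<Rightarrow> 'b::comm_monoid_mult"
  shows "(\<Prod>b\<in>Basis. f b) = (\<Prod>i\<in>UNIV. \<Prod>c\<in>Basis. f (axis i c))"
proof -
  define g where "g = (\<lambda>(i, c). axis i c :: 'a ^ 'n)"
  have "inj_on g (UNIV \<times> Basis)"
    by (auto simp: g_def inj_on_def axis_eq_axis)
  moreover have "Basis = g ` (UNIV \<times> Basis)"
    by (auto simp: g_def Basis_vec_def)
  ultimately have "(\<Prod>b\<in>Basis. f b) = (\<Prod>p\<in>UNIV \<times> Basis. f (g p))"
    using prod.reindex[of g "UNIV \<times> Basis" f] by (simp add: o_def)
  then show ?thesis
    by (simp add: prod.cartesian_product g_def split_def)
qed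

text \<open>Passing to the product measure on functions makes induction over the set of coordinates
  possible, which the type \<open>'a ^ 'n\<close> with its fixed index type does not allow.\<close>

lemma lborel_vec_eq_distr:
  "(lborel :: ('a::euclidean_space ^ 'n) measure) = distr (\<Pi>\<^sub>M i\<in>UNIV. lborel) borel vec_lambda"
proof (rule lborel_eqI)
  fix l u :: "'a ^ 'n"
  assume le: "\<And>b. b \<in> Basis \<Longrightarrow> l \<bullet> b \<le> u \<bullet> b"
  have le': "l $ i \<bullet> c \<le> u $ i \<bullet> c" if "c \<in> Basis" for i c
    using le[of "axis i c"] that by (auto simp: Basis_vec_def inner_axis)
  have "vec_lambda -` box l u = (\<Pi>\<^sub>E i\<in>UNIV. box (l $ i) (u $ i))"
    by (auto simp: box_def Basis_vec_def inner_axis PiE_def)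
  then have "emeasure (distr (\<Pi>\<^sub>M i\<in>UNIV. lborel) borel vec_lambda) (box l u) =
      emeasure (\<Pi>\<^sub>M i\<in>UNIV. lborel) (\<Pi>\<^sub>E i\<in>UNIV. box (l $ i) (u $ i))"
    by (subst emeasure_distr) (auto simp: space_PiM)
  also have "\<dots> = (\<Prod>i\<in>UNIV. emeasure lborel (box (l $ i) (u $ i)))"
    by (rule lborel_product.emeasure_PiM) auto
  also have "\<dots> = ennreal (\<Prod>i\<in>UNIV. \<Prod>c\<in>Basis. (u $ i - l $ i) \<bullet> c)"
    using le' by (subst prod_ennreal[symmetric])
      (auto intro!: prod_nonneg simp: inner_diff_left)
  also have "\<dots> = ennreal (\<Prod>b\<in>Basis. (u - l) \<bullet> b)"
    by (simp add: prod_Basis_vec inner_axis)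
  finally show "emeasure (distr (\<Pi>\<^sub>M i\<in>UNIV. lborel) borel vec_lambda) (box l u) =
      ennreal (\<Prod>b\<in>Basis. (u - l) \<bullet> b)" .
qed simp

lemma emeasure_lborel_cartesian_product:
  fixes D :: "'n::finite \<Rightarrow> complex set"
  assumes "\<And>j. open (D j)"
  shows "emeasure lborel (cartesian_product D) = (\<Prod>j\<in>UNIV. emeasure lborel (D j))"
proof -
  have o: "open (cartesian_product D)"
    unfolding cartesian_product_def using assms by (intro open_vector_box) auto
  have "vec_lambda -` cartesian_product D = (\<Pi>\<^sub>E j\<in>UNIV. D j)"
    by (auto simp: cartesian_product_def PiE_def)
  then have "emeasure lborel (cartesian_product D) = emeasure (\<Pi>\<^sub>M i\<in>UNIV. lborel) (\<Pi>\<^sub>E j\<in>UNIV. D j)"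
    using o by (subst lborel_vec_eq_distr, subst emeasure_distr) (auto simp: space_PiM)
  also have "\<dots> = (\<Prod>j\<in>UNIV. emeasure lborel (D j))"
    using assms by (intro lborel_product.emeasure_PiM) auto
  finally show ?thesis .
qed

text \<open>Induction on \<open>I\<close>: integrating out coordinate \<open>i\<close> against
  \<open>e i\<close> replaces \<open>F\<close> by its slice \<open>G\<close> with that coordinate
  frozen at \<open>z i\<close>. Vanishing off the product and holomorphy in each variable separately
  are conditions that pass from \<open>F\<close> to \<open>G\<close>. The conclusion evaluates at
  \<open>restrict z I\<close> because points of the product space are undefined outside
  \<open>I\<close>.\<close>

lemma product_planar_reproducing:
  fixes D :: "'i \<Rightarrow> complex set" and F :: "('i \<Rightarrow> complex) \<Rightarrow> complex"
  assumes D: "\<And>j. j \<in> I \<Longrightarrow> open (D j)" "\<And>j. j \<in> I \<Longrightarrow> z j \<in> D j"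
    and e: "\<And>j. j \<in> I \<Longrightarrow> e j \<in> planar_bergman_space (D j)"
    and rep: "\<And>j f. j \<in> I \<Longrightarrow> f \<in> planar_bergman_space (D j) \<Longrightarrow>
      (LINT w:D j|lborel. f w * cnj (e j w)) = f (z j)"
    and I: "finite I"
    and F: "F \<in> borel_measurable (\<Pi>\<^sub>M j\<in>I. lborel)"
      "\<And>x j. j \<in> I \<Longrightarrow> x j \<notin> D j \<Longrightarrow> F x = 0"
      "\<And>x i. i \<in> I \<Longrightarrow> (\<And>j. j \<in> I - {i} \<Longrightarrow> x j \<in> D j) \<Longrightarrow>
        (\<lambda>w. F (x(i := w))) holomorphic_on D i"
      "(\<integral>\<^sup>+x. ennreal ((norm (F x))\<^sup>2) \<partial>(\<Pi>\<^sub>M j\<in>I. lborel)) < \<infinity>"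
  shows "(\<integral>x. F x * (\<Prod>j\<in>I. cnj (indicator (D j) (x j) *\<^sub>R e j (x j))) \<partial>(\<Pi>\<^sub>M j\<in>I. lborel)) =
    F (restrict z I)"
  using I D e rep F
proof (induction I arbitrary: F rule: finite_induct)
  case empty
  then show ?case
    by (simp add: PiM_empty lebesgue_integral_count_space_finite)
next
  case (insert i I)
  note [measurable] = insert.prems(5)
  define E where "E = (\<lambda>j x. indicator (D j) x *\<^sub>R e j x)"
  define P where "P = (\<lambda>I x. \<Prod>j\<in>I. cnj (E j (x j)))"
  define G where "G = (\<lambda>x. F (x(i := z i)))"
  have Em: "E j \<in> borel_measurable lborel" if "j \<in> insert i I" for j
    using insert.prems(1,3)[OF that] set_borel_measurable_holomorphic[of "D j" "e j"]
    by (auto simp: E_def set_borel_measurable_def planar_bergman_space_def)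
  have Ei: "integrable lborel (\<lambda>w. (norm (E j w))\<^sup>2)" if "j \<in> insert i I" for j
  proof -
    have "(\<lambda>w. (norm (E j w))\<^sup>2) = (\<lambda>w. indicator (D j) w *\<^sub>R (norm (e j w))\<^sup>2)"
      by (auto simp: E_def indicator_def)
    then show ?thesis
      using insert.prems(3)[OF that] by (simp add: planar_bergman_space_def set_integrable_def)
  qed
  have cnjm [measurable]: "cnj \<in> borel_measurable borel"
    by (intro borel_measurable_continuous_onI continuous_intros)
  have Pm [measurable]: "P (insert i I) \<in> borel_measurable (\<Pi>\<^sub>M j\<in>insert i I. lborel)"
    unfolding P_def
    by (intro borel_measurable_prod measurable_compose[OF _ cnjm] measurable_compose[OF _ Em])
      (auto intro: measurable_component_singleton)
  have F2: "integrable (\<Pi>\<^sub>M j\<in>insert i I. lborel) (\<lambda>x. (norm (F x))\<^sup>2)"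
    using insert.prems(8) by (intro integrableI_bounded) auto
  have P2: "integrable (\<Pi>\<^sub>M j\<in>insert i I. lborel) (\<lambda>x. (norm (P (insert i I) x))\<^sup>2)"
    unfolding P_def prod_norm[symmetric] prod_power_distrib complex_mod_cnj
    using insert.hyps by (intro lborel_product.product_integrable_prod Ei) auto
  \<comment> \<open>Fubini needs the whole product to be integrable; it is dominated by the sum of
    the two squared norms.\<close>
  have int: "integrable (\<Pi>\<^sub>M j\<in>insert i I. lborel) (\<lambda>x. F x * P (insert i I) x)"
  proof (rule Bochner_Integration.integrable_bound[OF Bochner_Integration.integrable_add[OF F2 P2]])
    have "a * b \<le> a\<^sup>2 + b\<^sup>2" if "0 \<le> a" "0 \<le> b" for a b :: real
      using sum_squares_bound[of a b] mult_nonneg_nonneg[OF that] by simp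
    then show "AE x in \<Pi>\<^sub>M j\<in>insert i I. lborel. norm (F x * P (insert i I) x) \<le>
        norm ((norm (F x))\<^sup>2 + (norm (P (insert i I) x))\<^sup>2)"
      by (intro AE_I2) (simp add: norm_mult)
  qed measurable
  have Fupd [measurable]: "(\<lambda>(x, y). F (x(i := y))) \<in> borel_measurable ((\<Pi>\<^sub>M j\<in>I. lborel) \<Otimes>\<^sub>M lborel)"
    by measurable
  have zi: "z i \<in> D i" "open (D i)" using insert.prems by auto
  then obtain r where r: "r > 0" "ball (z i) r \<subseteq> D i" using openE by blast
  have Gm [measurable]: "G \<in> borel_measurable (\<Pi>\<^sub>M j\<in>I. lborel)"
    unfolding G_def by measurable
  have hol: "(\<lambda>w. F (x(i := w))) holomorphic_on D i" if "\<And>j. j \<in> I \<Longrightarrow> x j \<in> D j" for x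
    using insert.hyps that by (intro insert.prems(7)) auto
  have Fsq: "(\<integral>\<^sup>+x. \<integral>\<^sup>+y. ennreal ((norm (F (x(i := y))))\<^sup>2) \<partial>lborel \<partial>(\<Pi>\<^sub>M j\<in>I. lborel)) < \<infinity>"
    using insert.prems(8) insert.hyps by (subst (asm) lborel_product.product_nn_integral_insert) auto
  \<comment> \<open>The crucial estimate: \<open>G\<close> lives on a slice, which is a null set for
    the larger product, yet the area mean value inequality in variable \<open>i\<close> controls it
    by an integral over that variable.\<close>
  have G_le: "emeasure lborel (ball 0 r :: complex set) * ennreal ((norm (G x))\<^sup>2) \<le>
      (\<integral>\<^sup>+y. ennreal ((norm (F (x(i := y))))\<^sup>2) \<partial>lborel)" for x
  proof (cases "\<forall>j\<in>I. x j \<in> D j")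
    case True
    then have "(\<lambda>w. F (x(i := w))) holomorphic_on ball (z i) r"
      using hol r holomorphic_on_subset by blast
    then have "emeasure lborel (ball 0 r :: complex set) * ennreal ((norm (G x))\<^sup>2) \<le>
        (\<integral>\<^sup>+y\<in>ball (z i) r. ennreal ((norm (F (x(i := y))))\<^sup>2) \<partial>lborel)"
      unfolding G_def by (rule area_mean_value_inequality)
    also have "\<dots> \<le> (\<integral>\<^sup>+y. ennreal ((norm (F (x(i := y))))\<^sup>2) \<partial>lborel)"
      by (intro nn_integral_mono) (simp add: indicator_def)
    finally show ?thesis .
  next
    case False
    then obtain j where "j \<in> I" "x j \<notin> D j" by auto
    then have "G x = 0"
      unfolding G_def using insert.hyps by (intro insert.prems(6)[of j]) auto
    then show ?thesis by simp
  qed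
  have "emeasure lborel (ball 0 r :: complex set) * (\<integral>\<^sup>+x. ennreal ((norm (G x))\<^sup>2) \<partial>(\<Pi>\<^sub>M j\<in>I. lborel)) < \<infinity>"
  proof -
    have "emeasure lborel (ball 0 r :: complex set) * (\<integral>\<^sup>+x. ennreal ((norm (G x))\<^sup>2) \<partial>(\<Pi>\<^sub>M j\<in>I. lborel)) =
        (\<integral>\<^sup>+x. emeasure lborel (ball 0 r :: complex set) * ennreal ((norm (G x))\<^sup>2) \<partial>(\<Pi>\<^sub>M j\<in>I. lborel))"
      by (intro nn_integral_cmult[symmetric]) measurable
    also have "\<dots> \<le> (\<integral>\<^sup>+x. \<integral>\<^sup>+y. ennreal ((norm (F (x(i := y))))\<^sup>2) \<partial>lborel \<partial>(\<Pi>\<^sub>M j\<in>I. lborel))"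
      by (intro nn_integral_mono G_le)
    finally show ?thesis using Fsq by (rule le_less_trans)
  qed
  \<comment> \<open>A factor 0 would hide an infinite integral; a disc of positive area does
    not.\<close>
  moreover have "emeasure lborel (ball 0 r :: complex set) \<noteq> 0"
    using content_ball_pos[of r "0::complex"] r
    by (metis (no_types) enn2real_0 less_irrefl measure_def)
  ultimately have Gsq: "(\<integral>\<^sup>+x. ennreal ((norm (G x))\<^sup>2) \<partial>(\<Pi>\<^sub>M j\<in>I. lborel)) < \<infinity>"
    by (auto simp: ennreal_mult_less_top)
  \<comment> \<open>Tonelli gives square-integrable slices only for almost every \<open>x\<close>,
    so the reproducing property of \<open>e i\<close> is used under \<open>AE\<close>.\<close>
  have fin: "AE x in \<Pi>\<^sub>M j\<in>I. lborel. (\<integral>\<^sup>+y. ennreal ((norm (F (x(i := y))))\<^sup>2) \<partial>lborel) \<noteq> \<infinity>"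
    using Fsq by (intro nn_integral_PInf_AE) auto
  have inner: "AE x in \<Pi>\<^sub>M j\<in>I. lborel.
      (\<integral>y. F (x(i := y)) * P (insert i I) (x(i := y)) \<partial>lborel) = G x * P I x"
    using fin AE_space
  proof eventually_elim
    fix x assume fin: "(\<integral>\<^sup>+y. ennreal ((norm (F (x(i := y))))\<^sup>2) \<partial>lborel) \<noteq> \<infinity>"
      and x: "x \<in> space (\<Pi>\<^sub>M j\<in>I. lborel)"
    define f where "f = (\<lambda>w. F (x(i := w)))"
    have Pins: "P (insert i I) (x(i := y)) = cnj (E i y) * P I x" for y
      using insert.hyps by (auto simp: P_def intro!: prod.cong)
    have "(\<integral>y. F (x(i := y)) * P (insert i I) (x(i := y)) \<partial>lborel) =
        (\<integral>y. (f y * cnj (E i y)) * P I x \<partial>lborel)"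
      by (simp add: Pins f_def mult.assoc)
    also have "\<dots> = (\<integral>y. f y * cnj (E i y) \<partial>lborel) * P I x"
      by (rule integral_mult_left_zero)
    also have "(\<integral>y. f y * cnj (E i y) \<partial>lborel) = (LINT y:D i|lborel. f y * cnj (e i y))"
      unfolding set_lebesgue_integral_def E_def by (simp add: mult.left_commute scaleR_conv_of_real)
    also have "\<dots> = f (z i)"
    \<comment> \<open>Slices through the product are holomorphic; all other slices of
      \<open>F\<close> are identically zero, so the identity is trivial for them.\<close>
    proof (cases "\<forall>j\<in>I. x j \<in> D j")
      case True
      have fm: "f \<in> borel_measurable lborel"
        unfolding f_def using x by measurable
      have "f holomorphic_on D i" unfolding f_def using True by (intro hol) auto
      moreover have "integrable lborel (\<lambda>w. (norm (f w))\<^sup>2)"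
        using fin fm unfolding f_def[symmetric]
        by (intro integrableI_bounded) (auto simp: less_top f_def)
      then have "set_integrable lborel (D i) (\<lambda>w. (norm (f w))\<^sup>2)"
        unfolding set_integrable_def using zi by (intro integrable_mult_indicator) auto
      ultimately show ?thesis
        by (intro insert.prems(4)) (auto simp: planar_bergman_space_def)
    next
      case False
      then obtain j where "j \<in> I" "x j \<notin> D j" by auto
      then have "f y = 0" for y
        unfolding f_def using insert.hyps by (intro insert.prems(6)[of j]) auto
      then show ?thesis by simp
    qed
    finally show "(\<integral>y. F (x(i := y)) * P (insert i I) (x(i := y)) \<partial>lborel) = G x * P I x"
      by (simp only: f_def G_def)
  qed
  have P'm [measurable]: "P I \<in> borel_measurable (\<Pi>\<^sub>M j\<in>I. lborel)"
    unfolding P_def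
    by (intro borel_measurable_prod measurable_compose[OF _ cnjm] measurable_compose[OF _ Em])
      (auto intro: measurable_component_singleton)
  have "(\<integral>x. F x * P (insert i I) x \<partial>(\<Pi>\<^sub>M j\<in>insert i I. lborel)) =
      (\<integral>x. \<integral>y. F (x(i := y)) * P (insert i I) (x(i := y)) \<partial>lborel \<partial>(\<Pi>\<^sub>M j\<in>I. lborel))"
    by (rule lborel_product.product_integral_insert[OF insert.hyps int])
  also have "\<dots> = (\<integral>x. G x * P I x \<partial>(\<Pi>\<^sub>M j\<in>I. lborel))"
  proof (rule integral_cong_AE[OF _ _ inner])
    show "(\<lambda>x. \<integral>y. F (x(i := y)) * P (insert i I) (x(i := y)) \<partial>lborel) \<in> borel_measurable (\<Pi>\<^sub>M j\<in>I. lborel)"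
      by (rule lborel.borel_measurable_lebesgue_integral) measurable
    show "(\<lambda>x. G x * P I x) \<in> borel_measurable (\<Pi>\<^sub>M j\<in>I. lborel)"
      by measurable
  qed
  also have "\<dots> = G (restrict z I)"
    unfolding P_def E_def
  \<comment> \<open>Since \<open>z i\<close> lies in \<open>D i\<close>, freezing that coordinate
    keeps the hypotheses for the remaining ones.\<close>
  proof (rule insert.IH)
    show "G x = 0" if "j \<in> I" "x j \<notin> D j" for x j
      unfolding G_def using insert.hyps that by (intro insert.prems(6)[of j]) auto
    show "(\<lambda>w. G (x(k := w))) holomorphic_on D k"
      if k: "k \<in> I" and "\<And>j. j \<in> I - {k} \<Longrightarrow> x j \<in> D j" for x k
    proof -
      have "k \<noteq> i" using k insert.hyps by auto
      then have "(\<lambda>w. G (x(k := w))) = (\<lambda>w. F ((x(i := z i))(k := w)))"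
        by (simp add: G_def fun_upd_twist)
      moreover have "(\<lambda>w. F ((x(i := z i))(k := w))) holomorphic_on D k"
        using that zi by (intro insert.prems(7)) auto
      ultimately show ?thesis by (simp only:)
    qed
  qed (use insert.prems(1-4) Gm Gsq in auto)
  also have "\<dots> = F (restrict z (insert i I))"
    unfolding G_def by (rule arg_cong[where f = F]) (auto simp: restrict_def fun_eq_iff)
  finally show ?case by (simp only: P_def E_def)
qed

section \<open>The Bergman kernel of a product\<close>

lemma open_cartesian_product:
  assumes "\<And>j. open (D j)"
  shows "open (cartesian_product D)"
  unfolding cartesian_product_def using assms by (intro open_vector_box) auto

lemma holomorphic_Cn_cong:
  assumes "open \<Omega>" "\<And>z. z \<in> \<Omega> \<Longrightarrow> f z = g z" "holomorphic_Cn f \<Omega>"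
  shows "holomorphic_Cn g \<Omega>"
  unfolding holomorphic_Cn_def
proof
  fix z assume z: "z \<in> \<Omega>"
  then obtain f' where f': "(f has_derivative f') (at z)" "\<forall>c v. f' (c *s v) = c * f' v"
    using assms(3) by (auto simp: holomorphic_Cn_def)
  have "(g has_derivative f') (at z)"
    by (rule has_derivative_transform_within_open[OF f'(1) assms(1) z assms(2)])
  then show "\<exists>f'. (g has_derivative f') (at z) \<and> (\<forall>c v. f' (c *s v) = c * f' v)"
    using f'(2) by blast
qed

lemma holomorphic_Cn_component:
  assumes h: "h holomorphic_on D j" and D: "open (D j)"
  shows "holomorphic_Cn (\<lambda>z. h (z $ j)) (cartesian_product D)"
  unfolding holomorphic_Cn_def
proof
  fix z assume "z \<in> cartesian_product D"
  then have zj: "z $ j \<in> D j" by (simp add: cartesian_product_def)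
  have "(h has_derivative (*) (deriv h (z $ j))) (at (z $ j))"
    using holomorphic_derivI[OF h D zj] by (simp add: has_field_derivative_def)
  from has_derivative_compose[OF bounded_linear_imp_has_derivative[OF bounded_linear_vec_nth] this]
  have "((\<lambda>z. h (z $ j)) has_derivative (\<lambda>v. deriv h (z $ j) * v $ j)) (at z)" .
  then show "\<exists>f'. ((\<lambda>z. h (z $ j)) has_derivative f') (at z) \<and> (\<forall>c v. f' (c *s v) = c * f' v)"
    by (intro exI[of _ "\<lambda>v. deriv h (z $ j) * v $ j"]) (simp add: mult.left_commute)
qed

lemma holomorphic_Cn_mult:
  assumes "holomorphic_Cn f \<Omega>" "holomorphic_Cn g \<Omega>"
  shows "holomorphic_Cn (\<lambda>z. f z * g z) \<Omega>"
  unfolding holomorphic_Cn_def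
proof
  fix z assume "z \<in> \<Omega>"
  then obtain f' g' where f': "(f has_derivative f') (at z)" "\<forall>c v. f' (c *s v) = c * f' v"
    and g': "(g has_derivative g') (at z)" "\<forall>c v. g' (c *s v) = c * g' v"
    using assms unfolding holomorphic_Cn_def by blast
  from has_derivative_mult[OF f'(1) g'(1)] f'(2) g'(2)
  show "\<exists>h. ((\<lambda>z. f z * g z) has_derivative h) (at z) \<and> (\<forall>c v. h (c *s v) = c * h v)"
    by (intro exI[of _ "\<lambda>v. f z * g' v + f' v * g z"]) (simp add: algebra_simps)
qed

lemma holomorphic_Cn_prod:
  assumes "finite I" "\<And>j. j \<in> I \<Longrightarrow> holomorphic_Cn (f j) \<Omega>"
  shows "holomorphic_Cn (\<lambda>z. \<Prod>j\<in>I. f j z) \<Omega>"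
  using assms
proof (induction I rule: finite_induct)
  case empty
  show ?case by (auto simp: holomorphic_Cn_def intro!: exI[of _ "\<lambda>_. 0"])
next
  case (insert i I)
  then show ?case by (simp add: holomorphic_Cn_mult)
qed

lemma holomorphic_Cn_imp_continuous_on:
  assumes "holomorphic_Cn f \<Omega>"
  shows "continuous_on \<Omega> f"
  using assms unfolding holomorphic_Cn_def
  by (meson continuous_at_imp_continuous_on has_derivative_continuous)

text \<open>Moving one coordinate is an affine map with linear part \<open>axis i\<close>; complex
  linearity of the derivative turns the chain rule into multiplication by the number
  \<open>f' (axis i 1)\<close>.\<close>

lemma holomorphic_on_slice:
  fixes f :: "complex ^ 'n::finite \<Rightarrow> complex"
  assumes f: "holomorphic_Cn f \<Omega>" and S: "\<And>w. w \<in> S \<Longrightarrow> vec_lambda (x(i := w)) \<in> \<Omega>"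
  shows "(\<lambda>w. f (vec_lambda (x(i := w)))) holomorphic_on S"
  unfolding holomorphic_on_def
proof
  fix w assume "w \<in> S"
  then obtain f' where f': "(f has_derivative f') (at (vec_lambda (x(i := w))))"
    and lin: "\<And>c v. f' (c *s v) = c * f' v"
    using S f unfolding holomorphic_Cn_def by blast
  define c where "c = vec_lambda (x(i := 0))"
  have eq: "vec_lambda (x(i := w)) = c + axis i w" for w :: complex
    by (simp add: c_def vec_eq_iff axis_def)
  have "linear (axis i :: complex \<Rightarrow> complex ^ 'n)"
    by (rule linearI) (simp_all add: vec_eq_iff axis_def)
  then have bl: "bounded_linear (axis i :: complex \<Rightarrow> complex ^ 'n)"
    by (simp add: linear_conv_bounded_linear)
  have "((\<lambda>w. vec_lambda (x(i := w))) has_derivative axis i) (at w)"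
    unfolding eq by (rule derivative_eq_intros bounded_linear_imp_has_derivative[OF bl] refl | simp)+
  from has_derivative_compose[OF this f']
  have hd: "((\<lambda>w. f (vec_lambda (x(i := w)))) has_derivative (\<lambda>h. f' (axis i h))) (at w)" .
  have lin':  "f' (axis i h) = f' (axis i 1) * h" for h
  proof -
    have "axis i h = h *s axis i (1 :: complex)"
      by (simp add: vec_eq_iff axis_def)
    then show ?thesis by (simp add: lin mult.commute)
  qed
  have "((\<lambda>w. f (vec_lambda (x(i := w)))) has_field_derivative f' (axis i 1)) (at w)"
    unfolding has_field_derivative_def
    by (rule has_derivative_eq_rhs[OF hd]) (rule ext, rule lin')
  then show "(\<lambda>w. f (vec_lambda (x(i := w)))) field_differentiable at w within S"
    unfolding field_differentiable_def by (intro exI) (rule has_field_derivative_at_within)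
qed

text \<open>Computing the pairing of \<open>K z\<close> and \<open>L w\<close> in two ways gives \<open>cnj (K z w) = L w z\<close> for any
  two kernels; with \<open>L = K\<close> this shows that \<open>K\<close> is hermitian.\<close>

lemma bergman_kernel_eqI:
  assumes K: "is_bergman_kernel \<Omega> K"
  shows "bergman_kernel \<Omega> = K"
proof -
  have rep: "(LINT w:\<Omega>|lborel. f w * K z w) = f z"
    if "is_bergman_kernel \<Omega> K" "f \<in> bergman_space \<Omega>" "z \<in> \<Omega>" for K f z
    using that unfolding is_bergman_kernel_def by blast
  have mem: "(\<lambda>w. cnj (K z w)) \<in> bergman_space \<Omega>"
    if "is_bergman_kernel \<Omega> K" "z \<in> \<Omega>" for K z
    using that unfolding is_bergman_kernel_def by blast
  have swap: "cnj (K z w) = L w z"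
    if K: "is_bergman_kernel \<Omega> K" and L: "is_bergman_kernel \<Omega> L" and zw: "z \<in> \<Omega>" "w \<in> \<Omega>"
    for K L and z w
  proof -
    have "cnj (K z w) = (LINT x:\<Omega>|lborel. cnj (K z x) * L w x)"
      by (rule rep[OF L mem[OF K zw(1)] zw(2), symmetric])
    also have "\<dots> = cnj (LINT x:\<Omega>|lborel. cnj (L w x) * K z x)"
      unfolding set_lebesgue_integral_def
      by (subst Bochner_Integration.integral_cnj[symmetric]) (simp add: mult.commute)
    also have "(LINT x:\<Omega>|lborel. cnj (L w x) * K z x) = cnj (L w z)"
      by (rule rep[OF K mem[OF L zw(2)] zw(1)])
    finally show ?thesis by simp
  qed
  have "L = K" if L: "is_bergman_kernel \<Omega> L" for L
  proof (intro ext)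
    fix z w
    show "L z w = K z w"
    proof (cases "z \<in> \<Omega> \<and> w \<in> \<Omega>")
      case True
      \<comment> \<open>Both \<open>L z w\<close> and \<open>K z w\<close> equal
        \<open>cnj (K w z)\<close>.\<close>
      then show ?thesis
        using swap[OF K K, of w z] swap[OF K L, of w z] by simp
    next
      case False
      then show ?thesis using K L by (simp add: is_bergman_kernel_def)
    qed
  qed
  with K show ?thesis
    unfolding bergman_kernel_def by (rule the_equality)
qed

text \<open>On \<open>D\<close> this is the function \<open>w \<mapsto> K w z\<close> for the planar
  Bergman kernel \<open>K\<close>, that is, \<open>cnj (K z w)\<close>.\<close>

definition reproducing_element :: "complex set \<Rightarrow> complex \<Rightarrow> complex \<Rightarrow> complex" where
  "reproducing_element D z = (SOME e. e \<in> planar_bergman_space D \<and>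
     (\<forall>f\<in>planar_bergman_space D. (LINT w:D|lborel. f w * cnj (e w)) = f z))"

context
  fixes D :: "complex set"
  assumes D: "open D" "emeasure lborel D < \<infinity>"
begin

lemma
  assumes z: "z \<in> D"
  shows reproducing_element_in: "reproducing_element D z \<in> planar_bergman_space D"
    and reproducing_element_reproduces: "f \<in> planar_bergman_space D \<Longrightarrow>
      (LINT w:D|lborel. f w * cnj (reproducing_element D z w)) = f z"
  using someI_ex[OF planar_reproducing_element_exists[OF D z, unfolded Bex_def]]
  unfolding reproducing_element_def[symmetric] by auto

text \<open>Each side is the pairing of the two reproducing elements, up to conjugation. The
  symmetry is what makes the kernel, holomorphic in one argument by construction, holomorphic in
  \<open>z\<close> as well.\<close>

lemma reproducing_element_hermitian:
  assumes "z \<in> D" "w \<in> D"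
  shows "cnj (reproducing_element D z w) = reproducing_element D w z"
proof -
  define e where "e = reproducing_element D"
  have "e w z = (LINT x:D|lborel. e w x * cnj (e z x))"
    unfolding e_def using assms
    by (intro reproducing_element_reproduces[symmetric] reproducing_element_in)
  also have "\<dots> = cnj (LINT x:D|lborel. e z x * cnj (e w x))"
    unfolding set_lebesgue_integral_def
    by (subst Bochner_Integration.integral_cnj[symmetric]) (simp add: mult.commute)
  also have "(LINT x:D|lborel. e z x * cnj (e w x)) = e z w"
    unfolding e_def using assms
    by (intro reproducing_element_reproduces reproducing_element_in)
  finally show ?thesis by (simp add: e_def)
qed

end

context
  fixes D :: "'n::finite \<Rightarrow> complex set"
  assumes D: "\<And>j. open (D j)"
begin

lemma prod_in_bergman_space:
  assumes e: "\<And>j. e j \<in> planar_bergman_space (D j)"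
  shows "(\<lambda>w. \<Prod>j\<in>UNIV. e j (w $ j)) \<in> bergman_space (cartesian_product D)"
proof -
  let ?\<Omega> = "cartesian_product D"
  have hol: "holomorphic_Cn (\<lambda>w. \<Prod>j\<in>UNIV. e j (w $ j)) ?\<Omega>"
    using e D by (intro holomorphic_Cn_prod holomorphic_Cn_component) (auto simp: planar_bergman_space_def)
  have "integrable (\<Pi>\<^sub>M j\<in>UNIV. lborel) (\<lambda>x. \<Prod>j\<in>UNIV. indicator (D j) (x j) *\<^sub>R (norm (e j (x j)))\<^sup>2)"
    using e by (intro lborel_product.product_integrable_prod) (auto simp: planar_bergman_space_def set_integrable_def)
  also have "(\<lambda>x. \<Prod>j\<in>UNIV. indicator (D j) (x j) *\<^sub>R (norm (e j (x j)))\<^sup>2) =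
      (\<lambda>x. indicator ?\<Omega> (vec_lambda x) *\<^sub>R (norm (\<Prod>j\<in>UNIV. e j (vec_lambda x $ j)))\<^sup>2)" (is "?l = ?r")
  proof
    fix x
    show "?l x = ?r x"
    proof (cases "vec_lambda x \<in> ?\<Omega>")
      case True
      then show ?thesis
        by (simp add: cartesian_product_def prod_norm[symmetric] prod_power_distrib)
    next
      case False
      then obtain j where "x j \<notin> D j" by (auto simp: cartesian_product_def)
      then have "?l x = 0" by (intro prod_zero) (auto simp: indicator_def intro!: exI[of _ j])
      with False show ?thesis by simp
    qed
  qed
  finally have "integrable (\<Pi>\<^sub>M j\<in>UNIV. lborel) ?r" .
  moreover have "(\<lambda>w. indicator ?\<Omega> w *\<^sub>R (norm (\<Prod>j\<in>UNIV. e j (w $ j)))\<^sup>2) \<in> borel_measurable borel"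
    by (intro borel_measurable_continuous_on_indicator continuous_on_power continuous_on_norm
        holomorphic_Cn_imp_continuous_on hol borel_open open_cartesian_product D)
  ultimately have "set_integrable lborel ?\<Omega> (\<lambda>w. (norm (\<Prod>j\<in>UNIV. e j (w $ j)))\<^sup>2)"
    unfolding set_integrable_def lborel_vec_eq_distr
    by (subst integrable_distr_eq) auto
  with hol show ?thesis by (simp add: bergman_space_def)
qed

text \<open>The integral moves to the product measure, with \<open>f\<close> cut off to 0 outside
  the product domain; the cut-off function satisfies the slice conditions of
  \<open>product_planar_reproducing\<close>.\<close>

lemma cartesian_product_reproducing:
  assumes z: "z \<in> cartesian_product D"
    and e: "\<And>j. e j \<in> planar_bergman_space (D j)"
    and rep: "\<And>j f. f \<in> planar_bergman_space (D j) \<Longrightarrow>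
      (LINT w:D j|lborel. f w * cnj (e j w)) = f (z $ j)"
    and f: "f \<in> bergman_space (cartesian_product D)"
  shows "(LINT w:cartesian_product D|lborel. f w * cnj (\<Prod>j\<in>UNIV. e j (w $ j))) = f z"
proof -
  let ?\<Omega> = "cartesian_product D"
  define F where "F = (\<lambda>x. indicator ?\<Omega> (vec_lambda x) *\<^sub>R f (vec_lambda x))"
  have hol: "holomorphic_Cn f ?\<Omega>" using f by (simp add: bergman_space_def)
  have o: "open ?\<Omega>" by (rule open_cartesian_product[OF D])
  have fm: "(\<lambda>w. indicator ?\<Omega> w *\<^sub>R f w) \<in> borel_measurable borel"
    using holomorphic_Cn_imp_continuous_on[OF hol] o
    by (intro borel_measurable_continuous_on_indicator) auto
  have fm2: "(\<lambda>w. ennreal ((norm (indicator ?\<Omega> w *\<^sub>R f w))\<^sup>2)) \<in> borel_measurable borel"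
    by (rule measurable_compose[OF fm]) measurable
  have "holomorphic_Cn (\<lambda>w. \<Prod>j\<in>UNIV. e j (w $ j)) ?\<Omega>"
    using prod_in_bergman_space[of e] e by (simp add: bergman_space_def)
  then have m: "(\<lambda>w. indicator ?\<Omega> w *\<^sub>R (f w * cnj (\<Prod>j\<in>UNIV. e j (w $ j)))) \<in> borel_measurable borel"
    using hol o
    by (intro borel_measurable_continuous_on_indicator continuous_on_mult continuous_on_cnj
        holomorphic_Cn_imp_continuous_on) auto
  have "(LINT w:?\<Omega>|lborel. f w * cnj (\<Prod>j\<in>UNIV. e j (w $ j))) =
      (\<integral>x. indicator ?\<Omega> (vec_lambda x) *\<^sub>R (f (vec_lambda x) * cnj (\<Prod>j\<in>UNIV. e j (vec_lambda x $ j)))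
        \<partial>(\<Pi>\<^sub>M j\<in>UNIV. lborel))"
    unfolding set_lebesgue_integral_def lborel_vec_eq_distr
    using m by (subst integral_distr) auto
  also have "\<dots> = (\<integral>x. F x * (\<Prod>j\<in>UNIV. cnj (indicator (D j) (x j) *\<^sub>R e j (x j))) \<partial>(\<Pi>\<^sub>M j\<in>UNIV. lborel))"
    by (intro Bochner_Integration.integral_cong) (auto simp: F_def indicator_def cartesian_product_def)
  also have "\<dots> = F (restrict (($) z) UNIV)"
  proof (rule product_planar_reproducing)
    show "F \<in> borel_measurable (\<Pi>\<^sub>M j\<in>UNIV. lborel)"
      unfolding F_def by (rule measurable_compose[OF vec_lambda_measurable_PiM fm])
    show "F x = 0" if "x j \<notin> D j" for x j
      using that by (auto simp: F_def indicator_def cartesian_product_def)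
    show "(\<lambda>w. F (x(i := w))) holomorphic_on D i" if "\<And>j. j \<in> UNIV - {i} \<Longrightarrow> x j \<in> D j" for x i
    proof -
      have in\<Omega>: "vec_lambda (x(i := w)) \<in> ?\<Omega>" if "w \<in> D i" for w
        using that \<open>\<And>j. j \<in> UNIV - {i} \<Longrightarrow> x j \<in> D j\<close> by (auto simp: cartesian_product_def)
      have "(\<lambda>w. f (vec_lambda (x(i := w)))) holomorphic_on D i"
        by (rule holomorphic_on_slice[OF hol in\<Omega>])
      then show ?thesis
        by (rule holomorphic_transform) (simp add: F_def in\<Omega> del: fun_upd_apply)
    qed
    have "(\<integral>\<^sup>+x. ennreal ((norm (F x))\<^sup>2) \<partial>(\<Pi>\<^sub>M j\<in>UNIV. lborel)) =
        (\<integral>\<^sup>+w. ennreal ((norm (indicator ?\<Omega> w *\<^sub>R f w))\<^sup>2) \<partial>lborel)"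
      unfolding F_def
      by (subst lborel_vec_eq_distr, subst nn_integral_distr)
        (simp_all only: measurable_distr_eq1 vec_lambda_measurable_PiM fm2)
    also have "\<dots> = (\<integral>\<^sup>+w. ennreal (norm (indicator ?\<Omega> w *\<^sub>R (norm (f w))\<^sup>2)) \<partial>lborel)"
      by (intro nn_integral_cong) (simp add: indicator_def)
    also have "\<dots> < \<infinity>"
      using f by (simp add: bergman_space_def set_integrable_def integrable_iff_bounded)
    finally show "(\<integral>\<^sup>+x. ennreal ((norm (F x))\<^sup>2) \<partial>(\<Pi>\<^sub>M j\<in>UNIV. lborel)) < \<infinity>" .
  qed (use D z e rep in \<open>auto simp: cartesian_product_def\<close>)
  also have "\<dots> = f z"
    using z by (simp add: F_def vec_nth_inverse restrict_UNIV)
  finally show ?thesis .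
qed

lemma bergman_kernel_cartesian_product:
  assumes fin: "\<And>j. emeasure lborel (D j) < \<infinity>"
    and z: "z \<in> cartesian_product D" and w: "w \<in> cartesian_product D"
  shows "bergman_kernel (cartesian_product D) z w =
    cnj (\<Prod>j\<in>UNIV. reproducing_element (D j) (z $ j) (w $ j))"
proof -
  let ?\<Omega> = "cartesian_product D"
  let ?e = "\<lambda>j. reproducing_element (D j)"
  \<comment> \<open>The value 0 off the product is prescribed by \<open>is_bergman_kernel\<close>.
    The conjugate appears because a reproducing element at \<open>z\<close> is
    \<open>cnj (K z w)\<close> as a function of \<open>w\<close>.\<close>
  define K where "K = (\<lambda>z w. if z \<in> ?\<Omega> \<and> w \<in> ?\<Omega> then cnj (\<Prod>j\<in>UNIV. ?e j (z $ j) (w $ j)) else 0)"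
  have o: "open ?\<Omega>" by (rule open_cartesian_product[OF D])
  have in_D: "x $ j \<in> D j" if "x \<in> ?\<Omega>" for x j
    using that by (simp add: cartesian_product_def)
  have pbs: "?e j (x $ j) \<in> planar_bergman_space (D j)" if "x \<in> ?\<Omega>" for x j
    by (rule reproducing_element_in[OF D fin in_D[OF that]])
  have "is_bergman_kernel ?\<Omega> K"
    unfolding is_bergman_kernel_def
  proof (intro conjI ballI allI impI)
    fix w assume w: "w \<in> ?\<Omega>"
    have "holomorphic_Cn (\<lambda>z. \<Prod>j\<in>UNIV. ?e j (w $ j) (z $ j)) ?\<Omega>"
      using prod_in_bergman_space[OF pbs[OF w]] by (simp add: bergman_space_def)
    then show "holomorphic_Cn (\<lambda>z. K z w) ?\<Omega>"
      by (rule holomorphic_Cn_cong[OF o, rotated])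
        (use w in \<open>simp add: K_def reproducing_element_hermitian[OF D fin in_D in_D]\<close>)
  next
    fix z assume z: "z \<in> ?\<Omega>"
    have P: "(\<lambda>w. \<Prod>j\<in>UNIV. ?e j (z $ j) (w $ j)) \<in> bergman_space ?\<Omega>"
      by (rule prod_in_bergman_space[OF pbs[OF z]])
    have "holomorphic_Cn (\<lambda>w. cnj (K z w)) ?\<Omega>"
      by (rule holomorphic_Cn_cong[OF o, of "\<lambda>w. \<Prod>j\<in>UNIV. ?e j (z $ j) (w $ j)"])
        (use P z in \<open>simp_all add: K_def bergman_space_def\<close>)
    moreover have "indicator ?\<Omega> w *\<^sub>R (norm (cnj (K z w)))\<^sup>2 =
        indicator ?\<Omega> w *\<^sub>R (norm (\<Prod>j\<in>UNIV. ?e j (z $ j) (w $ j)))\<^sup>2" for w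
      using z by (simp add: K_def indicator_def prod_norm[symmetric])
    ultimately show "(\<lambda>w. cnj (K z w)) \<in> bergman_space ?\<Omega>"
      using P by (simp only: bergman_space_def set_integrable_def mem_Collect_eq)
  next
    fix f z assume f: "f \<in> bergman_space ?\<Omega>" and z: "z \<in> ?\<Omega>"
    have "(LINT w:?\<Omega>|lborel. f w * K z w) =
        (LINT w:?\<Omega>|lborel. f w * cnj (\<Prod>j\<in>UNIV. ?e j (z $ j) (w $ j)))"
      unfolding set_lebesgue_integral_def
      by (intro Bochner_Integration.integral_cong) (use z in \<open>auto simp: K_def indicator_def\<close>)
    also have "\<dots> = f z"
      by (rule cartesian_product_reproducing[OF z pbs[OF z]
            reproducing_element_reproduces[OF D fin in_D[OF z]] f])
    finally show "(LINT w:?\<Omega>|lborel. f w * K z w) = f z" .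
  qed (auto simp: K_def)
  then have "bergman_kernel ?\<Omega> = K" by (rule bergman_kernel_eqI)
  then show ?thesis using z w by (simp add: K_def)
qed

end

section \<open>The Bergman span of a product\<close>

context
  fixes D :: "'n::finite \<Rightarrow> complex set"
  assumes D: "\<And>j. open (D j)"
begin

text \<open>Only factor \<open>j\<close> varies in direction \<open>j\<close>, and the conjugate of
  a holomorphic function has as its derivative by \<open>cnj w\<close> the conjugate of the complex
  derivative.\<close>

lemma dbar_prod_cnj:
  assumes h: "\<And>i. h i holomorphic_on D i"
    and g: "\<And>w. w \<in> cartesian_product D \<Longrightarrow> g w = (\<Prod>i\<in>UNIV. cnj (h i (w $ i)))"
    and w: "w \<in> cartesian_product D"
  shows "dbar j g w = (\<Prod>i\<in>UNIV. cnj ((h(j := deriv (h j))) i (w $ i)))"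
proof -
  define C where "C = (\<Prod>i\<in>UNIV - {j}. cnj (h i (w $ i)))"
  define d where "d = deriv (h j) (w $ j)"
  have wj: "w $ j \<in> D j" using w by (simp add: cartesian_product_def)
  have der: "vector_derivative (\<lambda>t. g (w + t *\<^sub>R axis j v)) (at 0) = C * cnj (d * v)" for v
  proof (rule vector_derivative_at)
    have "((\<lambda>t. w $ j + t *\<^sub>R v) has_vector_derivative v) (at 0)"
      by (auto intro!: derivative_eq_intros)
    from field_vector_diff_chain_at[OF this, of "h j" d]
    have "((\<lambda>t. h j (w $ j + t *\<^sub>R v)) has_vector_derivative v * d) (at 0)"
      using holomorphic_derivI[OF h D wj] by (simp add: o_def d_def)
    then have "((\<lambda>t. C * cnj (h j (w $ j + t *\<^sub>R v))) has_vector_derivative C * cnj (d * v)) (at 0)"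
      by (intro has_vector_derivative_mult_right has_vector_derivative_cnj) (simp add: mult.commute)
    then show "((\<lambda>t. g (w + t *\<^sub>R axis j v)) has_vector_derivative C * cnj (d * v)) (at 0)"
    proof (rule has_vector_derivative_transform_within_open)
      show "open ((\<lambda>t. w + t *\<^sub>R axis j v) -` cartesian_product D)"
        by (intro open_vimage open_cartesian_product D continuous_intros)
      show "0 \<in> (\<lambda>t. w + t *\<^sub>R axis j v) -` cartesian_product D"
        using w by simp
      fix t assume "t \<in> (\<lambda>t. w + t *\<^sub>R axis j v) -` cartesian_product D"
      then have "g (w + t *\<^sub>R axis j v) = (\<Prod>i\<in>UNIV. cnj (h i ((w + t *\<^sub>R axis j v) $ i)))"
        using g by simp
      also have "\<dots> = cnj (h j (w $ j + t *\<^sub>R v)) * C"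
        unfolding C_def by (subst prod.remove[of _ j]) (auto simp: axis_def intro!: prod.cong)
      finally show "C * cnj (h j (w $ j + t *\<^sub>R v)) = g (w + t *\<^sub>R axis j v)"
        by (simp add: mult.commute)
    qed
  qed
  \<comment> \<open>Direction 1 contributes \<open>C * cnj d\<close>; direction \<open>\<i>\<close>
    contributes \<open>- \<i> * C * cnj d\<close>, which the factor \<open>\<i>\<close> in
    \<open>dbar\<close> turns into the same value.\<close>
  have "dbar j g w = cnj d * C"
    unfolding dbar_def der by (simp add: algebra_simps)
  also have "\<dots> = (\<Prod>i\<in>UNIV. cnj ((h(j := deriv (h j))) i (w $ i)))"
    unfolding C_def d_def by (subst (2) prod.remove[of _ j]) (auto intro!: prod.cong)
  finally show ?thesis .
qed

text \<open>Since \<open>g\<close> is only required to be a product on the open product domain, the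
  formula for \<open>m\<close> derivatives can be fed back as the hypothesis for the next
  one.\<close>

lemma dbar_funpow_prod_cnj:
  assumes h: "\<And>i. h i holomorphic_on D i"
    and g: "\<And>w. w \<in> cartesian_product D \<Longrightarrow> g w = (\<Prod>i\<in>UNIV. cnj (h i (w $ i)))"
    and w: "w \<in> cartesian_product D"
  shows "(dbar j ^^ m) g w = (\<Prod>i\<in>UNIV. cnj ((h(j := (deriv ^^ m) (h j))) i (w $ i)))"
  using w
proof (induction m arbitrary: w)
  case 0
  then show ?case by (simp add: g)
next
  case (Suc m)
  have "(h(j := (deriv ^^ m) (h j))) i holomorphic_on D i" for i
    using h[of i] h[of j] D by (auto intro: holomorphic_higher_deriv)
  from dbar_prod_cnj[OF this Suc.IH Suc.prems, of j]
  have "(dbar j ^^ Suc m) g w =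
      (\<Prod>i\<in>UNIV. cnj ((h(j := (deriv ^^ m) (h j), j := deriv ((deriv ^^ m) (h j)))) i (w $ i)))"
    by (simp del: fun_upd_apply add: fun_upd_same)
  then show ?case by (simp only: fun_upd_upd) simp
qed

lemma dbar_multi_prod_cnj:
  assumes h: "\<And>i. h i holomorphic_on D i"
    and g: "\<And>w. w \<in> cartesian_product D \<Longrightarrow> g w = (\<Prod>i\<in>UNIV. cnj (h i (w $ i)))"
    and w: "w \<in> cartesian_product D"
  shows "dbar_multi \<alpha> g w = (\<Prod>i\<in>UNIV. cnj ((deriv ^^ \<alpha> i) (h i) (w $ i)))"
proof -
  have *: "foldr (\<lambda>j. dbar j ^^ \<alpha> j) js g w =
      (\<Prod>i\<in>UNIV. cnj ((if i \<in> set js then (deriv ^^ \<alpha> i) (h i) else h i) (w $ i)))"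
    if "distinct js" "w \<in> cartesian_product D" for js w
    using that
  proof (induction js arbitrary: w)
    case Nil
    then show ?case by (simp add: g)
  next
    case (Cons j js)
    \<comment> \<open>\<open>foldr\<close> applies the head of the list last, so the coordinates in
      \<open>js\<close> have already been differentiated, and distinctness leaves factor
      \<open>j\<close> untouched so far.\<close>
    let ?h = "\<lambda>i. if i \<in> set js then (deriv ^^ \<alpha> i) (h i) else h i"
    have "?h i holomorphic_on D i" for i
      using h D by (auto intro: holomorphic_higher_deriv)
    moreover have "foldr (\<lambda>j. dbar j ^^ \<alpha> j) js g w = (\<Prod>i\<in>UNIV. cnj (?h i (w $ i)))"
      if "w \<in> cartesian_product D" for w
      using Cons.IH[OF _ that] Cons.prems by simp
    ultimately have "(dbar j ^^ \<alpha> j) (foldr (\<lambda>j. dbar j ^^ \<alpha> j) js g) w =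
        (\<Prod>i\<in>UNIV. cnj ((?h(j := (deriv ^^ \<alpha> j) (?h j))) i (w $ i)))"
      using Cons.prems by (intro dbar_funpow_prod_cnj)
    also have "?h(j := (deriv ^^ \<alpha> j) (?h j)) =
        (\<lambda>i. if i \<in> set (j # js) then (deriv ^^ \<alpha> i) (h i) else h i)"
      using Cons.prems by (auto simp: fun_eq_iff)
    finally show ?case by simp
  qed
  have "distinct (index_list :: 'n list) \<and> set (index_list :: 'n list) = UNIV"
    unfolding index_list_def
    by (rule someI_ex) (use finite_distinct_list[of "UNIV :: 'n set"] in auto)
  then show ?thesis
    unfolding dbar_multi_def using *[OF _ w, of index_list] by simp
qed

end

text \<open>The derivative of order \<open>a\<close> of the planar kernel with respect to
  \<open>cnj w\<close>, read as a function of \<open>\<zeta>\<close>: a generator of the planar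
  Bergman span.\<close>

definition kernel_derivative :: "complex set \<Rightarrow> nat \<Rightarrow> complex \<Rightarrow> complex \<Rightarrow> complex" where
  "kernel_derivative D a w \<zeta> = cnj ((deriv ^^ a) (reproducing_element D \<zeta>) w)"

text \<open>The hinge of both implications: a generator for the product is a product of planar
  generators, and any choice of one planar generator per coordinate arises this way.\<close>

lemma dbar_multi_bergman_kernel:
  fixes D :: "'n::finite \<Rightarrow> complex set"
  assumes D: "\<And>j. open (D j)" "\<And>j. emeasure lborel (D j) < \<infinity>"
    and zw: "z \<in> cartesian_product D" "w \<in> cartesian_product D"
  shows "dbar_multi \<alpha> (bergman_kernel (cartesian_product D) z) w =
    (\<Prod>j\<in>UNIV. kernel_derivative (D j) (\<alpha> j) (w $ j) (z $ j))"
  unfolding kernel_derivative_def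
proof (rule dbar_multi_prod_cnj[OF D(1) _ _ zw(2)])
  fix j
  have "z $ j \<in> D j" using zw by (simp add: cartesian_product_def)
  then show "reproducing_element (D j) (z $ j) holomorphic_on D j"
    using reproducing_element_in[OF D] by (simp add: planar_bergman_space_def)
next
  fix w assume "w \<in> cartesian_product D"
  then show "bergman_kernel (cartesian_product D) z w =
      (\<Prod>j\<in>UNIV. cnj (reproducing_element (D j) (z $ j) (w $ j)))"
    using bergman_kernel_cartesian_product[OF D zw(1)] by simp
qed

section \<open>The Bergman span as a vector space\<close>

lemma bergman_span_cong:
  assumes "f \<in> bergman_span \<Omega>" "\<And>z. z \<in> \<Omega> \<Longrightarrow> f z = g z"
  shows "g \<in> bergman_span \<Omega>"
  using assms by (auto simp: bergman_span_def)

lemma bergman_span_generator: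
  assumes "w \<in> \<Omega>"
  shows "(\<lambda>z. dbar_multi \<alpha> (bergman_kernel \<Omega> z) w) \<in> bergman_span \<Omega>"
  using assms unfolding bergman_span_def
  by (auto intro!: exI[of _ "{(\<alpha>, w)}"] exI[of _ "\<lambda>_. 1"])

lemma bergman_span_scale:
  assumes "f \<in> bergman_span \<Omega>"
  shows "(\<lambda>z. a * f z) \<in> bergman_span \<Omega>"
proof -
  obtain S c where S: "finite S" "S \<subseteq> UNIV \<times> \<Omega>"
    "\<forall>z\<in>\<Omega>. f z = (\<Sum>(\<alpha>, w0)\<in>S. c (\<alpha>, w0) * dbar_multi \<alpha> (bergman_kernel \<Omega> z) w0)"
    using assms unfolding bergman_span_def by blast
  then show ?thesis
    unfolding bergman_span_def
    by (auto intro!: exI[of _ S] exI[of _ "\<lambda>s. a * c s"] simp: sum_distrib_left split_def mult.assoc)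
qed

lemma bergman_span_add:
  assumes "f \<in> bergman_span \<Omega>" "g \<in> bergman_span \<Omega>"
  shows "(\<lambda>z. f z + g z) \<in> bergman_span \<Omega>"
proof -
  let ?b = "\<lambda>z s. dbar_multi (fst s) (bergman_kernel \<Omega> z) (snd s)"
  obtain S c where S: "finite S" "S \<subseteq> UNIV \<times> \<Omega>" "\<forall>z\<in>\<Omega>. f z = (\<Sum>s\<in>S. c s * ?b z s)"
    using assms(1) unfolding bergman_span_def split_def prod.collapse by blast
  obtain T d where T: "finite T" "T \<subseteq> UNIV \<times> \<Omega>" "\<forall>z\<in>\<Omega>. g z = (\<Sum>s\<in>T. d s * ?b z s)"
    using assms(2) unfolding bergman_span_def split_def prod.collapse by blast
  \<comment> \<open>The two index sets may overlap; coefficients are extended by zero to the union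
    and added there.\<close>
  define e where "e = (\<lambda>s. (if s \<in> S then c s else 0) + (if s \<in> T then d s else 0))"
  have "f z + g z = (\<Sum>s\<in>S \<union> T. e s * ?b z s)" if "z \<in> \<Omega>" for z
  proof -
    have "(\<Sum>s\<in>S. c s * ?b z s) = (\<Sum>s\<in>S \<union> T. (if s \<in> S then c s else 0) * ?b z s)"
      using S T by (intro sum.mono_neutral_cong_left) auto
    moreover have "(\<Sum>s\<in>T. d s * ?b z s) = (\<Sum>s\<in>S \<union> T. (if s \<in> T then d s else 0) * ?b z s)"
      using S T by (intro sum.mono_neutral_cong_left) auto
    ultimately show ?thesis
      using S T that by (simp add: e_def distrib_right sum.distrib)
  qed
  then show ?thesis
    using S T unfolding bergman_span_def split_def prod.collapse
    by (intro CollectI exI[of _ "S \<union> T"] exI[of _ e]) auto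
qed

lemma bergman_span_sum:
  assumes "finite A" "\<And>a. a \<in> A \<Longrightarrow> f a \<in> bergman_span \<Omega>"
  shows "(\<lambda>z. \<Sum>a\<in>A. f a z) \<in> bergman_span \<Omega>"
  using assms
proof (induction A rule: finite_induct)
  case empty
  show ?case by (auto simp: bergman_span_def intro!: exI[of _ "{}"])
next
  case (insert a A)
  then show ?case by (simp add: bergman_span_add)
qed

text \<open>By linearity only monomials matter, and the constant 1 of the quadrature condition is
  the monomial with exponent zero.\<close>

lemma QDP_iff_monomials:
  fixes \<Omega> :: "(complex ^ 'n::finite) set"
  shows "QDP \<Omega> \<longleftrightarrow> is_domain \<Omega> \<and> finite_volume \<Omega> \<and>
    (\<forall>\<alpha>. (\<lambda>z. \<Prod>j\<in>UNIV. (z $ j) ^ \<alpha> j) \<in> bergman_span \<Omega>)" (is "_ \<longleftrightarrow> _ \<and> _ \<and> ?R")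
proof -
  have mono: "holomorphic_polynomial (\<lambda>z :: complex ^ 'n. \<Prod>j\<in>UNIV. (z $ j) ^ \<alpha> j)" for \<alpha>
    unfolding holomorphic_polynomial_def by (intro exI[of _ "{\<alpha>}"] exI[of _ "\<lambda>_. 1"]) simp
  have "p \<in> bergman_span \<Omega>" if R: ?R and p: "holomorphic_polynomial p" for p
  proof -
    obtain A a where "finite A" "p = (\<lambda>z. \<Sum>\<alpha>\<in>A. a \<alpha> * (\<Prod>j\<in>UNIV. (z $ j) ^ \<alpha> j))"
      using p unfolding holomorphic_polynomial_def by blast
    then show ?thesis
      using R by (auto intro!: bergman_span_sum bergman_span_scale)
  qed
  moreover have "(\<lambda>z. 1) \<in> bergman_span \<Omega>" if ?R
    using spec[OF that, of "\<lambda>_. 0"] by simp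
  ultimately show ?thesis
    using mono unfolding QDP_def quadrature_domain_def by blast
qed

section \<open>Products of domains\<close>

lemma is_domain_cartesian_product:
  fixes D :: "'n::finite \<Rightarrow> complex set"
  assumes "\<And>j. is_domain (D j)"
  shows "is_domain (cartesian_product D)"
  unfolding is_domain_def
proof (intro conjI)
  have D: "D j \<noteq> {}" "open (D j)" "path_connected (D j)" for j
    using assms[of j] by (auto simp: is_domain_def connected_open_path_connected)
  show "open (cartesian_product D)"
    using D by (intro open_cartesian_product)
  have "vec_lambda (\<lambda>j. SOME z. z \<in> D j) \<in> cartesian_product D"
    using D(1) by (auto simp: cartesian_product_def some_in_eq)
  then show "cartesian_product D \<noteq> {}" by blast
  \<comment> \<open>Open connected sets are path connected, and paths in the factors combine
    coordinatewise.\<close>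
  have "path_connected (cartesian_product D)"
    unfolding path_connected_def
  proof (intro ballI)
    fix x y assume xy: "x \<in> cartesian_product D" "y \<in> cartesian_product D"
    have "\<exists>g. path g \<and> path_image g \<subseteq> D j \<and> pathstart g = x $ j \<and> pathfinish g = y $ j" for j
      using D(3)[of j] xy unfolding path_connected_def cartesian_product_def by blast
    then obtain g where g: "\<And>j. path (g j)" "\<And>j. path_image (g j) \<subseteq> D j"
      "\<And>j. pathstart (g j) = x $ j" "\<And>j. pathfinish (g j) = y $ j"
      by metis
    show "\<exists>g. path g \<and> path_image g \<subseteq> cartesian_product D \<and> pathstart g = x \<and> pathfinish g = y"
    proof (intro exI conjI)
      show "path (\<lambda>t. \<chi> j. g j t)"
        using g(1) unfolding path_def by (intro continuous_on_vec_lambda)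
      show "path_image (\<lambda>t. \<chi> j. g j t) \<subseteq> cartesian_product D"
        using g(2) by (fastforce simp: path_image_def cartesian_product_def)
    qed (use g(3,4) in \<open>auto simp: pathstart_def pathfinish_def vec_eq_iff\<close>)
  qed
  then show "connected (cartesian_product D)" by (rule path_connected_imp_connected)
qed

lemma finite_volume_cartesian_product:
  fixes D :: "'n::finite \<Rightarrow> complex set"
  assumes "\<And>j. open (D j)" "\<And>j. finite_volume (D j)"
  shows "finite_volume (cartesian_product D)"
  using assms by (auto simp: finite_volume_def emeasure_lborel_cartesian_product ennreal_prod_eq_top less_top[symmetric])

text \<open>Through this identity the formulas for product kernels also describe the planar
  spans.\<close>

lemma planar_eq_cartesian_product: "planar D = cartesian_product (\<lambda>_. D)"
  by (auto simp: planar_def cartesian_product_def)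

lemma planar_monomial_in_span:
  fixes D :: "'n::finite \<Rightarrow> complex set"
  assumes D: "\<And>j. open (D j)" "\<And>j. emeasure lborel (D j) < \<infinity>"
    and z0: "z0 \<in> cartesian_product D"
    and span: "(\<lambda>z. (z $ j) ^ a) \<in> bergman_span (cartesian_product D)"
  shows "(\<lambda>z. (z $ 1) ^ a) \<in> bergman_span (planar (D j))"
proof -
  let ?\<Omega> = "cartesian_product D"
  let ?k = "\<lambda>i. kernel_derivative (D i)"
  obtain S c where S: "finite S" "S \<subseteq> UNIV \<times> ?\<Omega>"
    and eq: "\<And>z. z \<in> ?\<Omega> \<Longrightarrow>
      (z $ j) ^ a = (\<Sum>s\<in>S. c s * dbar_multi (fst s) (bergman_kernel ?\<Omega> z) (snd s))"
    using span unfolding bergman_span_def split_def prod.collapse by blast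
  define C where "C = (\<lambda>s. c s * (\<Prod>i\<in>UNIV - {j}. ?k i (fst s i) (snd s $ i) (z0 $ i)))"
  \<comment> \<open>Indices in \<open>S\<close> that differ only outside coordinate \<open>j\<close>
    yield the same planar generator, so the sum stays indexed by \<open>S\<close> and the closure of
    the span under sums absorbs repetitions.\<close>
  define g where "g = (\<lambda>s z. dbar_multi (\<lambda>_. fst s j) (bergman_kernel (planar (D j)) z) (vec (snd s $ j)))"
  have "(\<lambda>z. \<Sum>s\<in>S. C s * g s z) \<in> bergman_span (planar (D j))"
    unfolding g_def using S
    by (intro bergman_span_sum bergman_span_scale bergman_span_generator)
      (auto simp: planar_def cartesian_product_def)
  then show ?thesis
  proof (rule bergman_span_cong)
    fix z :: "complex ^ 1" assume z: "z \<in> planar (D j)"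
    define Z where "Z = (\<chi> i. if i = j then z $ 1 else z0 $ i)"
    have Z: "Z \<in> ?\<Omega>"
      using z z0 by (auto simp: Z_def planar_def cartesian_product_def)
    have "C s * g s z = c s * dbar_multi (fst s) (bergman_kernel ?\<Omega> Z) (snd s)" if s: "s \<in> S" for s
    proof -
      have sin: "snd s \<in> ?\<Omega>" using S s by auto
      have "g s z = ?k j (fst s j) (snd s $ j) (z $ 1)"
        unfolding g_def planar_eq_cartesian_product
        using z sin by (subst dbar_multi_bergman_kernel)
          (use D in \<open>auto simp: planar_def cartesian_product_def\<close>)
      moreover have "dbar_multi (fst s) (bergman_kernel ?\<Omega> Z) (snd s) =
          ?k j (fst s j) (snd s $ j) (z $ 1) * (\<Prod>i\<in>UNIV - {j}. ?k i (fst s i) (snd s $ i) (z0 $ i))"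
        using sin Z by (subst dbar_multi_bergman_kernel[OF D], simp, simp, subst prod.remove[of _ j])
          (auto simp: Z_def intro!: prod.cong)
      ultimately show ?thesis by (simp add: C_def mult_ac)
    qed
    then have "(\<Sum>s\<in>S. C s * g s z) = (Z $ j) ^ a"
      using eq[OF Z] by simp
    then show "(\<Sum>s\<in>S. C s * g s z) = (z $ 1) ^ a"
      by (simp add: Z_def)
  qed
qed

text \<open>Multiplying out one planar sum per coordinate gives a sum over choice functions
  \<open>\<sigma>\<close>. The chosen orders form a multi-index, the chosen points form a point of
  the product domain, and together they name a generator.\<close>

lemma monomial_in_product_span:
  fixes D :: "'n::finite \<Rightarrow> complex set"
  assumes D: "\<And>j. open (D j)" "\<And>j. emeasure lborel (D j) < \<infinity>"
    and span: "\<And>j. (\<lambda>z. (z $ 1) ^ \<alpha> j) \<in> bergman_span (planar (D j))"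
  shows "(\<lambda>z. \<Prod>j\<in>UNIV. (z $ j) ^ \<alpha> j) \<in> bergman_span (cartesian_product D)"
proof -
  let ?\<Omega> = "cartesian_product D"
  have "\<exists>S c. finite S \<and> S \<subseteq> UNIV \<times> planar (D j) \<and> (\<forall>z\<in>planar (D j).
      (z $ 1) ^ \<alpha> j = (\<Sum>s\<in>S. c s * dbar_multi (fst s) (bergman_kernel (planar (D j)) z) (snd s)))"
    (is "\<exists>S c. ?P j S c") for j
    using span[of j] unfolding bergman_span_def split_def prod.collapse by blast
  \<comment> \<open>Index set and coefficients are bundled in a pair, so that a single choice over
    \<open>j\<close> yields both.\<close>
  then have "\<forall>j. \<exists>Sc. ?P j (fst Sc) (snd Sc)"
    by simp
  from choice[OF this] obtain Sc where Sc: "\<forall>j. ?P j (fst (Sc j)) (snd (Sc j))" ..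
  define S c where "S = (\<lambda>j. fst (Sc j))" and "c = (\<lambda>j. snd (Sc j))"
  have S: "\<And>j. finite (S j)" "\<And>j. S j \<subseteq> UNIV \<times> planar (D j)"
    and eq: "\<And>j z. z \<in> planar (D j) \<Longrightarrow>
      (z $ 1) ^ \<alpha> j = (\<Sum>s\<in>S j. c j s * dbar_multi (fst s) (bergman_kernel (planar (D j)) z) (snd s))"
    unfolding S_def c_def using Sc by simp_all
  define g where "g = (\<lambda>(\<sigma> :: 'n \<Rightarrow> (1 \<Rightarrow> nat) \<times> (complex ^ 1)) z. dbar_multi (\<lambda>j. fst (\<sigma> j) 1) (bergman_kernel ?\<Omega> z) (\<chi> j. snd (\<sigma> j) $ 1))"
  have \<sigma>: "(\<chi> j. snd (\<sigma> j) $ 1) \<in> ?\<Omega>" if "\<sigma> \<in> PiE UNIV S" for \<sigma>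
  proof -
    have "\<sigma> j \<in> UNIV \<times> planar (D j)" for j
      using PiE_mem[OF that UNIV_I] S(2) by blast
    then show ?thesis
      by (simp add: cartesian_product_def planar_def mem_Times_iff)
  qed
  have "(\<lambda>z. \<Sum>\<sigma>\<in>PiE UNIV S. (\<Prod>j\<in>UNIV. c j (\<sigma> j)) * g \<sigma> z) \<in> bergman_span ?\<Omega>"
    unfolding g_def using S(1) \<sigma>
    by (intro bergman_span_sum bergman_span_scale bergman_span_generator finite_PiE) auto
  then show ?thesis
  proof (rule bergman_span_cong)
    fix z assume z: "z \<in> ?\<Omega>"
    have "(z $ j) ^ \<alpha> j = (\<Sum>s\<in>S j. c j s * kernel_derivative (D j) (fst s 1) (snd s $ 1) (z $ j))" for j
    proof -
      have zj: "vec (z $ j) \<in> planar (D j)"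
        using z by (simp add: planar_def cartesian_product_def)
      have "dbar_multi (fst s) (bergman_kernel (planar (D j)) (vec (z $ j))) (snd s) =
          kernel_derivative (D j) (fst s 1) (snd s $ 1) (z $ j)" if "s \<in> S j" for s
        using that S(2)[of j] zj unfolding planar_eq_cartesian_product
        by (subst dbar_multi_bergman_kernel) (use D in auto)
      then show ?thesis using eq[OF zj] by simp
    qed
    then have "(\<Prod>j\<in>UNIV. (z $ j) ^ \<alpha> j) =
        (\<Prod>j\<in>UNIV. \<Sum>s\<in>S j. c j s * kernel_derivative (D j) (fst s 1) (snd s $ 1) (z $ j))"
      by simp
    also have "\<dots> = (\<Sum>\<sigma>\<in>PiE UNIV S. \<Prod>j\<in>UNIV. c j (\<sigma> j) *
        kernel_derivative (D j) (fst (\<sigma> j) 1) (snd (\<sigma> j) $ 1) (z $ j))"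
      using S(1) by (intro prod_sum_PiE) auto
    also have "\<dots> = (\<Sum>\<sigma>\<in>PiE UNIV S. (\<Prod>j\<in>UNIV. c j (\<sigma> j)) * g \<sigma> z)"
      using \<sigma> z by (intro sum.cong) (simp_all add: g_def dbar_multi_bergman_kernel[OF D] prod.distrib)
    finally show "(\<Sum>\<sigma>\<in>PiE UNIV S. (\<Prod>j\<in>UNIV. c j (\<sigma> j)) * g \<sigma> z) = (\<Prod>j\<in>UNIV. (z $ j) ^ \<alpha> j)" ..
  qed
qed

theorem proposition2p3:
  fixes \<Omega> :: "'n::finite \<Rightarrow> complex set"
  assumes "\<And>j. is_domain (\<Omega> j)"
    and "\<And>j. smooth_boundary (\<Omega> j)"
    and "\<And>j. finite_volume (\<Omega> j)"
    and "finite_volume (cartesian_product \<Omega>)"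
  shows "QDP (cartesian_product \<Omega>) \<longleftrightarrow> (\<forall>j. QDP (planar (\<Omega> j)))"
proof -
  have D: "open (\<Omega> j)" "emeasure lborel (\<Omega> j) < \<infinity>" for j
    using assms(1,3)[of j] by (simp_all add: is_domain_def finite_volume_def)
  have dom: "is_domain (cartesian_product \<Omega>)" "is_domain (planar (\<Omega> j))" for j
    unfolding planar_eq_cartesian_product by (intro is_domain_cartesian_product assms(1))+
  have vol: "finite_volume (planar (\<Omega> j))" for j
    unfolding planar_eq_cartesian_product by (intro finite_volume_cartesian_product D assms(3))
  obtain z0 where z0: "z0 \<in> cartesian_product \<Omega>"
    using dom(1) by (auto simp: is_domain_def)
  show ?thesis
    unfolding QDP_iff_monomials
  proof (intro iffI conjI allI dom vol assms(4))
    fix j and \<alpha> :: "1 \<Rightarrow> nat"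
    assume "is_domain (cartesian_product \<Omega>) \<and> finite_volume (cartesian_product \<Omega>) \<and>
      (\<forall>\<alpha>. (\<lambda>z. \<Prod>j\<in>UNIV. (z $ j) ^ \<alpha> j) \<in> bergman_span (cartesian_product \<Omega>))"
    then have "\<forall>\<alpha>. (\<lambda>z. \<Prod>j\<in>UNIV. (z $ j) ^ \<alpha> j) \<in> bergman_span (cartesian_product \<Omega>)"
      by blast
    \<comment> \<open>The multi-index supported at \<open>j\<close> turns the monomial into a power
      of the single variable \<open>z $ j\<close>.\<close>
    note spec[OF this, of "\<lambda>i. if i = j then \<alpha> 1 else 0"]
    also have "(\<lambda>z. \<Prod>i\<in>UNIV. (z $ i) ^ (if i = j then \<alpha> 1 else 0)) = (\<lambda>z :: complex ^ 'n. (z $ j) ^ \<alpha> 1)"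
      by (simp add: if_distrib cong: if_cong)
    finally have "(\<lambda>z. (z $ 1) ^ \<alpha> 1) \<in> bergman_span (planar (\<Omega> j))"
      by (rule planar_monomial_in_span[OF D z0])
    then show "(\<lambda>z. \<Prod>i\<in>UNIV. (z $ i) ^ \<alpha> i) \<in> bergman_span (planar (\<Omega> j))"
      by simp
  next
    fix \<alpha> :: "'n \<Rightarrow> nat"
    assume R: "\<forall>j. is_domain (planar (\<Omega> j)) \<and> finite_volume (planar (\<Omega> j)) \<and>
      (\<forall>\<alpha>. (\<lambda>z. \<Prod>i\<in>UNIV. (z $ i) ^ \<alpha> i) \<in> bergman_span (planar (\<Omega> j)))"
    show "(\<lambda>z. \<Prod>j\<in>UNIV. (z $ j) ^ \<alpha> j) \<in> bergman_span (cartesian_product \<Omega>)"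
    proof (rule monomial_in_product_span[OF D])
      fix j
      have "\<forall>\<alpha>. (\<lambda>z. \<Prod>i\<in>UNIV. (z $ i) ^ \<alpha> i) \<in> bergman_span (planar (\<Omega> j))"
        using R by blast
      from spec[OF this, of "\<lambda>_. \<alpha> j"]
      show "(\<lambda>z. (z $ 1) ^ \<alpha> j) \<in> bergman_span (planar (\<Omega> j))" by simp
    qed
  qed
qed

end
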